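(* Let $d\ge 2$ and let $\mathcal{Q}_d$ be the set of all $d$-variate quasi-copulas equipped with the uniform distance $\|A-B\|_\infty=\sup_{\mathbf{u}\in[0,1]^d}|A(\mathbf{u})-B(\mathbf{u})|$. Let $M\in\mathcal{Q}_d$ be the copula $M(\mathbf{u})=\min\{u_1,\dots,u_d\}$, let $\mathcal{U}$ be an arbitrary (arbitrarily small) neighborhood of $M$ in $\mathcal{Q}_d$, and let $\mathcal{S}$ be the set of all shuffles of elements of $\mathcal{U}$. Then $\mathcal{S}\cap\mathcal{Q}_d$ is a dense subset of $\mathcal{Q}_d$.
   Context: A $d$-variate quasi-copula is a function $A\colon[0,1]^d\to[0,1]$ such that (i) $A(1,\ldots,1,u_j,1,\ldots,1)=u_j$ for every $j\in\{1,\dots,d\}$ and $u_j\in[0,1]$; (ii) $A$ is increasing (non-decreasing) in each variable; (iii) $|A(\mathbf{v})-A(\mathbf{u})|\le\sum_{j=1}^d|v_j-u_j|$ for all $\mathbf{u},\mathbf{v}\in[0,1]^d$. For a box $R=(x_1,y_1]\times\cdots\times(x_d,y_d]\subseteq[0,1]^d$ put $V_A(R)=\sum_{\mathbf{v}}\operatorname{sign}_R(\mathbf{v})A(\mathbf{v})$, the sum being over $\mathbf{v}\in\{x_1,y_1\}\times\cdots\times\{x_d,y_d\}$, with $\operatorname{sign}_R(\mathbf v)=1$ if $v_j=x_j$ for an even number of indices $j$ and $-1$ otherwise. A quasi-copula $Q$ induces a unique finitely-additive signed measure $\mu_Q$ on the algebra of finite disjoint unions of half-open boxes in $[0,1]^d$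 with $\mu_Q(R)=V_Q(R)$ for all half-open boxes $R$. Shuffle: for each $k\in\{1,\dots,d\}$ let $J_i^k=(a_{i-1}^k,a_i^k]$, $i=1,\dots,n_k$, be a partition of $(0,1]$ with $0=a_0^k\le a_1^k\le\cdots\le a_{n_k}^k=1$, let $\pi_k$ be a permutation of $\{1,\dots,n_k\}$, and let $\phi_k\colon[0,1]\to[0,1]$ be given by $\phi_k(0)=0$ and $\phi_k(t)=t-a_{i-1}^k+\sum_{j:\,\pi_k(j)<\pi_k(i)}\lambda(J_j^k)$ for $t\in J_i^k$, where $\lambda$ is Lebesgue measure. Put $\phi(t_1,\dots,t_d)=(\phi_1(t_1),\dots,\phi_d(t_d))$. The function $(x_1,\dots,x_d)\mapsto\mu_Q\big(\phi^{-1}((0,x_1]\times\cdots\times(0,x_d])\big)$ on $[0,1]^d$ is called a shuffle of $Q$ (any choice of partitions and permutations is allowed; a shuffle of a quasi-copula need not be a quasi-copula). *)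

theory Defs
  imports "HOL-Analysis.Analysis"
begin

section \<open>Quasi-copulas\<close>

definition unit_cube :: "(real ^ 'n) set" where
  "unit_cube = {u. \<forall>j. 0 \<le> u $ j \<and> u $ j \<le> 1}"

text \<open>
  Functions on the unit cube are represented by their extensional representatives
  (\<^const>\<open>undefined\<close> off the cube), so that equality in HOL is equality on the cube.
\<close>

definition quasi_copulas :: "(real ^ 'n \<Rightarrow> real) set" where
  "quasi_copulas = {A. A \<in> unit_cube \<rightarrow>\<^sub>E {0..1}
     \<and> (\<forall>j. \<forall>t\<in>{0..1}. A (\<chi> k. if k = j then t else 1) = t)
     \<and> (\<forall>u\<in>unit_cube. \<forall>j. \<forall>t. u $ j \<le> t \<and> t \<le> 1 \<longrightarrow> A u \<le> A (\<chi> k. if k = j then t else u $ k))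
     \<and> (\<forall>u\<in>unit_cube. \<forall>v\<in>unit_cube. \<bar>A v - A u\<bar> \<le> (\<Sum>j\<in>UNIV. \<bar>v $ j - u $ j\<bar>))}"

definition min_copula :: "real ^ 'n \<Rightarrow> real" where
  "min_copula = (\<lambda>u\<in>unit_cube. Min (range (\<lambda>j. u $ j)))"

text \<open>
  The value 0 outside of \<^const>\<open>quasi_copulas\<close> is irrelevant; it is there because the locale
  \<^locale>\<open>Metric_space\<close> demands non-negativity and symmetry on the whole type.
\<close>

definition uniform_dist :: "(real ^ 'n \<Rightarrow> real) \<Rightarrow> (real ^ 'n \<Rightarrow> real) \<Rightarrow> real" where
  "uniform_dist A B =
     (if A \<in> quasi_copulas \<and> B \<in> quasi_copulas then SUP u\<in>unit_cube. \<bar>A u - B u\<bar> else 0)"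

definition quasi_copula_topology :: "(real ^ 'n \<Rightarrow> real) topology" where
  "quasi_copula_topology = Metric_space.mtopology quasi_copulas uniform_dist"


section \<open>The signed measure induced by a function on the unit cube\<close>

definition half_open_box :: "real ^ 'n \<Rightarrow> real ^ 'n \<Rightarrow> (real ^ 'n) set" where
  "half_open_box x y = {u. \<forall>j. x $ j < u $ j \<and> u $ j \<le> y $ j}"

definition box_sign :: "real ^ 'n \<Rightarrow> real ^ 'n \<Rightarrow> real" where
  "box_sign x v = (if even (card {j. v $ j = x $ j}) then 1 else - 1)"

text \<open>
  The vertices form a set, so this is meant for non-degenerate boxes only
  (\<open>x $ j < y $ j\<close> for all \<open>j\<close>); the empty set is treated as the empty union of boxes below.
\<close>

definition box_volume :: "(real ^ 'n \<Rightarrow> real) \<Rightarrow> real ^ 'n \<Rightarrow> real ^ 'n \<Rightarrow> real" where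
  "box_volume A x y = (\<Sum>v\<in>{v. \<forall>j. v $ j \<in> {x $ j, y $ j}}. box_sign x v * A v)"

definition half_open_boxes :: "(real ^ 'n) set set" where
  "half_open_boxes =
     {half_open_box x y | x y. x \<in> unit_cube \<and> y \<in> unit_cube \<and> (\<forall>j. x $ j < y $ j)}"

definition box_algebra :: "(real ^ 'n) set set" where
  "box_algebra = {\<Union>P | P. finite P \<and> P \<subseteq> half_open_boxes \<and> disjoint P}"

definition is_induced_measure :: "(real ^ 'n \<Rightarrow> real) \<Rightarrow> ((real ^ 'n) set \<Rightarrow> real) \<Rightarrow> bool" where
  "is_induced_measure Q \<mu> \<longleftrightarrow>
     \<mu> \<in> extensional box_algebra \<and> additive box_algebra \<mu> \<and>
     (\<forall>x\<in>unit_cube. \<forall>y\<in>unit_cube. (\<forall>j. x $ j < y $ j) \<longrightarrow> \<mu> (half_open_box x y) = box_volume Q x y)"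

text \<open>Existence and uniqueness are proved below (\<open>ex1_induced_measure\<close>).\<close>

definition induced_measure :: "(real ^ 'n \<Rightarrow> real) \<Rightarrow> (real ^ 'n) set \<Rightarrow> real" where
  "induced_measure Q = (THE \<mu>. is_induced_measure Q \<mu>)"


section \<open>Shuffles\<close>

text \<open>
  \<open>n\<close>, \<open>a\<close> and \<open>p\<close> are the number of intervals, their end points \<open>a 0 \<le> \<dots> \<le> a n\<close> and the
  permutation in one coordinate. The intervals \<open>{a (i - 1)<..a i}\<close>, some of which may be empty,
  partition \<open>{0<..1}\<close>.
\<close>

definition shuffle_data :: "nat \<Rightarrow> (nat \<Rightarrow> real) \<Rightarrow> (nat \<Rightarrow> nat) \<Rightarrow> bool" where
  "shuffle_data n a p \<longleftrightarrow>
     a 0 = 0 \<and> a n = 1 \<and> (\<forall>i\<in>{1..n}. a (i - 1) \<le> a i) \<and> p permutes {1..n}"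

definition shuffle_coord :: "nat \<Rightarrow> (nat \<Rightarrow> real) \<Rightarrow> (nat \<Rightarrow> nat) \<Rightarrow> real \<Rightarrow> real" where
  "shuffle_coord n a p t =
     (if t = 0 then 0
      else let i = (THE i. i \<in> {1..n} \<and> t \<in> {a (i - 1)<..a i})
           in t - a (i - 1) + (\<Sum>j | j \<in> {1..n} \<and> p j < p i. measure lborel {a (j - 1)<..a j}))"

definition shuffle_map ::
  "('n \<Rightarrow> nat) \<Rightarrow> ('n \<Rightarrow> nat \<Rightarrow> real) \<Rightarrow> ('n \<Rightarrow> nat \<Rightarrow> nat) \<Rightarrow> real ^ 'n \<Rightarrow> real ^ 'n" where
  "shuffle_map n a p t = (\<chi> k. shuffle_coord (n k) (a k) (p k) (t $ k))"

definition shuffles_of :: "(real ^ 'n \<Rightarrow> real) \<Rightarrow> (real ^ 'n \<Rightarrow> real) set" where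
  "shuffles_of Q =
     {(\<lambda>x\<in>unit_cube. induced_measure Q {t \<in> unit_cube. shuffle_map n a p t \<in> half_open_box 0 x})
      | n a p. \<forall>k. shuffle_data (n k) (a k) (p k)}"


section \<open>Well-definedness\<close>

lemma zero_in_unit_cube: "0 \<in> unit_cube"
  by (simp add: unit_cube_def)

lemma quasi_copula_range: "A \<in> quasi_copulas \<Longrightarrow> u \<in> unit_cube \<Longrightarrow> 0 \<le> A u \<and> A u \<le> 1"
  by (force simp: quasi_copulas_def PiE_iff)

lemma uniform_dist_bdd:
  assumes "A \<in> quasi_copulas" "B \<in> quasi_copulas"
  shows "bdd_above ((\<lambda>u. \<bar>A u - B u\<bar>) ` unit_cube)"
proof (rule bdd_aboveI2)
  fix u :: "real ^ 'a" assume "u \<in> unit_cube"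
  then show "\<bar>A u - B u\<bar> \<le> 1"
    using quasi_copula_range[OF assms(1)] quasi_copula_range[OF assms(2)] by (smt (verit))
qed

lemma uniform_dist_upper:
  assumes "A \<in> quasi_copulas" "B \<in> quasi_copulas" "u \<in> unit_cube"
  shows "\<bar>A u - B u\<bar> \<le> uniform_dist A B"
  using assms cSUP_upper[OF _ uniform_dist_bdd[OF assms(1,2)]] by (simp add: uniform_dist_def)

lemma uniform_dist_least:
  assumes "A \<in> quasi_copulas" "B \<in> quasi_copulas" "\<And>u. u \<in> unit_cube \<Longrightarrow> \<bar>A u - B u\<bar> \<le> c"
  shows "uniform_dist A B \<le> c"
  using assms zero_in_unit_cube by (auto simp: uniform_dist_def intro!: cSUP_least)

lemma Metric_space_quasi_copulas:
  "Metric_space (quasi_copulas :: (real ^ 'n \<Rightarrow> real) set) uniform_dist"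
proof
  fix A B C :: "real ^ 'n \<Rightarrow> real"
  show "0 \<le> uniform_dist A B"
  proof (cases "A \<in> quasi_copulas \<and> B \<in> quasi_copulas")
    case True
    then show ?thesis
      using uniform_dist_upper[of A B 0] zero_in_unit_cube by (smt (verit))
  qed (auto simp: uniform_dist_def)
  show "uniform_dist A B = uniform_dist B A"
    by (auto simp: uniform_dist_def abs_minus_commute)
  assume A: "A \<in> quasi_copulas" and B: "B \<in> quasi_copulas"
  show "uniform_dist A B = 0 \<longleftrightarrow> A = B"
  proof
    assume 0: "uniform_dist A B = 0"
    show "A = B"
    proof (rule extensionalityI)
      show "A \<in> extensional unit_cube" "B \<in> extensional unit_cube"
        using A B by (auto simp: quasi_copulas_def PiE_iff)
      fix u :: "real ^ 'n" assume "u \<in> unit_cube"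
      then show "A u = B u" using uniform_dist_upper[OF A B] 0 by fastforce
    qed
  next
    assume "A = B"
    then show "uniform_dist A B = 0"
      using zero_in_unit_cube by (auto simp: uniform_dist_def intro: cSUP_const)
  qed
  assume C: "C \<in> quasi_copulas"
  show "uniform_dist A C \<le> uniform_dist A B + uniform_dist B C"
  proof (rule uniform_dist_least[OF A C])
    fix u :: "real ^ 'n" assume u: "u \<in> unit_cube"
    show "\<bar>A u - C u\<bar> \<le> uniform_dist A B + uniform_dist B C"
      using uniform_dist_upper[OF A B u] uniform_dist_upper[OF B C u] by linarith
  qed
qed

lemma min_copula_quasi_copula: "(min_copula :: real ^ 'n \<Rightarrow> real) \<in> quasi_copulas"
proof -
  have mn: "min_copula u = Min (range (\<lambda>j. u $ j))" if "u \<in> unit_cube" for u :: "real ^ 'n"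
    using that by (simp add: min_copula_def)
  have le: "min_copula u \<le> u $ j" if "u \<in> unit_cube" for u :: "real ^ 'n" and j
    using that by (simp add: mn)
  have ge: "c \<le> min_copula u \<longleftrightarrow> (\<forall>j. c \<le> u $ j)" if "u \<in> unit_cube" for u :: "real ^ 'n" and c
    using that by (simp add: mn)
  have 1: "(min_copula :: real ^ 'n \<Rightarrow> real) \<in> unit_cube \<rightarrow>\<^sub>E {0..1}"
  proof (rule PiE_I)
    fix u :: "real ^ 'n" assume u: "u \<in> unit_cube"
    have "u $ undefined \<le> 1" using u by (simp add: unit_cube_def)
    then have "min_copula u \<le> 1" using le[OF u, of undefined] by simp
    moreover have "0 \<le> min_copula u" using u by (simp add: ge) (simp add: unit_cube_def)
    ultimately show "min_copula u \<in> {0..1}" by simp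
  qed (simp add: min_copula_def)
  have 2: "min_copula (\<chi> k. if k = j then t else 1) = t" if "t \<in> {0..1}" for t and j :: 'n
  proof -
    have u: "(\<chi> k. if k = j then t else 1) \<in> unit_cube" using that by (simp add: unit_cube_def)
    show ?thesis
      using le[OF u, of j] ge[OF u, of t] that by (intro antisym) auto
  qed
  have 3: "min_copula u \<le> min_copula (\<chi> k. if k = j then t else u $ k)"
    if "u \<in> unit_cube" "u $ j \<le> t" "t \<le> 1" for u :: "real ^ 'n" and j t
  proof -
    have "(\<chi> k. if k = j then t else u $ k) \<in> unit_cube"
      using that by (auto simp: unit_cube_def intro: order_trans)
    then show ?thesis using le[OF that(1)] that by (auto simp: ge intro: order_trans)
  qed
  have 4: "min_copula u - min_copula v \<le> (\<Sum>j\<in>UNIV. \<bar>v $ j - u $ j\<bar>)"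
    if "u \<in> unit_cube" "v \<in> unit_cube" for u v :: "real ^ 'n"
  proof -
    have "min_copula u - (\<Sum>j\<in>UNIV. \<bar>v $ j - u $ j\<bar>) \<le> v $ k" for k
    proof -
      have "\<bar>v $ k - u $ k\<bar> \<le> (\<Sum>j\<in>UNIV. \<bar>v $ j - u $ j\<bar>)"
        by (rule member_le_sum) auto
      then show ?thesis using le[OF that(1), of k] by linarith
    qed
    then show ?thesis using ge[OF that(2)] by (smt (verit))
  qed
  have 5: "\<bar>min_copula v - min_copula u\<bar> \<le> (\<Sum>j\<in>UNIV. \<bar>v $ j - u $ j\<bar>)"
    if "u \<in> unit_cube" "v \<in> unit_cube" for u v :: "real ^ 'n"
    using 4[OF that] 4[OF that(2,1)] by (simp add: abs_le_iff abs_minus_commute)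
  show ?thesis
    unfolding quasi_copulas_def using 1 2 3 5 by blast
qed

lemma finite_box_vertices: "finite {v :: real ^ 'n. \<forall>j. v $ j \<in> {x $ j, y $ j}}"
proof (rule finite_subset)
  show "{v :: real ^ 'n. \<forall>j. v $ j \<in> {x $ j, y $ j}}
          \<subseteq> vec_lambda ` (\<Pi>\<^sub>E j\<in>UNIV. {x $ j, y $ j})"
    by (auto simp: image_iff PiE_iff intro!: bexI[of _ "\<lambda>j. _ $ j"])
qed (auto intro!: finite_imageI finite_PiE)

lemma box_volume_step:
  fixes x y g :: "real ^ 'n"
  assumes xy: "\<And>j. x $ j < y $ j"
  shows "box_volume (\<lambda>u. of_bool (\<forall>j. g $ j \<le> u $ j)) x y = of_bool (g \<in> half_open_box x y)"
proof -
  let ?f = "\<lambda>j t. (if t = x $ j then - 1 else 1 :: real) * of_bool (g $ j \<le> t)"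
  have sgn: "box_sign x v = (\<Prod>j\<in>UNIV. if v $ j = x $ j then - 1 else 1)" for v :: "real ^ 'n"
    by (simp add: box_sign_def prod.If_cases minus_one_power_iff)
  have ob: "of_bool (\<forall>j. P j) = (\<Prod>j\<in>UNIV. of_bool (P j) :: real)" for P :: "'n \<Rightarrow> bool"
    by (induction rule: case_split[of "\<forall>j. P j"]) (auto intro!: prod_zero[symmetric])
  have "box_volume (\<lambda>u. of_bool (\<forall>j. g $ j \<le> u $ j)) x y
      = (\<Sum>v\<in>{v. \<forall>j. v $ j \<in> {x $ j, y $ j}}. \<Prod>j\<in>UNIV. ?f j (v $ j))"
    by (simp add: box_volume_def sgn ob flip: prod.distrib)
  also have "\<dots> = (\<Sum>h\<in>(\<Pi>\<^sub>E j\<in>UNIV. {x $ j, y $ j}). \<Prod>j\<in>UNIV. ?f j (h j))"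
    by (rule sum.reindex_bij_witness[of _ vec_lambda vec_nth]) (auto simp: PiE_iff)
  also have "\<dots> = (\<Prod>j\<in>UNIV. \<Sum>t\<in>{x $ j, y $ j}. ?f j t)"
    by (rule prod_sum_PiE[symmetric]) auto
  also have "\<dots> = (\<Prod>j\<in>UNIV. of_bool (x $ j < g $ j \<and> g $ j \<le> y $ j))"
  proof (rule prod.cong)
    fix j
    show "(\<Sum>t\<in>{x $ j, y $ j}. ?f j t) = of_bool (x $ j < g $ j \<and> g $ j \<le> y $ j)"
      using xy[of j] by (auto simp: of_bool_def)
  qed simp
  also have "\<dots> = of_bool (g \<in> half_open_box x y)"
    by (simp add: ob half_open_box_def)
  finally show ?thesis .
qed

text \<open>On a finite set every function is the distribution function of finitely many point masses.\<close>

lemma point_masses: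
  fixes F :: "real ^ 'n \<Rightarrow> real"
  assumes "finite S"
  shows "\<exists>m. \<forall>u\<in>S. F u = (\<Sum>g\<in>S. m g * of_bool (\<forall>j. g $ j \<le> u $ j))"
  using assms
proof (induction "card S" arbitrary: S)
  case (Suc k)
  then have "S \<noteq> {}" by auto
  then obtain s where s: "s \<in> S" "\<And>t. t \<in> S \<Longrightarrow> s \<le> t \<Longrightarrow> t = s"
    using finite_has_maximal[OF Suc.prems] by metis
  have "k = card (S - {s})" "finite (S - {s})"
    using Suc.hyps(2)[symmetric] Suc.prems s(1) by auto
  from Suc.hyps(1)[OF this]
  obtain m where m: "\<forall>u\<in>S - {s}. F u = (\<Sum>g\<in>S - {s}. m g * of_bool (\<forall>j. g $ j \<le> u $ j))"
    by blast
  define m' where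
    "m' = m(s := F s - (\<Sum>g\<in>S - {s}. m g * of_bool (\<forall>j. g $ j \<le> s $ j)))"
  have "F u = (\<Sum>g\<in>S. m' g * of_bool (\<forall>j. g $ j \<le> u $ j))" if u: "u \<in> S" for u
  proof -
    have "(\<Sum>g\<in>S. m' g * of_bool (\<forall>j. g $ j \<le> u $ j))
        = m' s * of_bool (\<forall>j. s $ j \<le> u $ j)
          + (\<Sum>g\<in>S - {s}. m g * of_bool (\<forall>j. g $ j \<le> u $ j))"
      unfolding sum.remove[OF Suc.prems s(1)]
      by (intro arg_cong2[where f = "(+)"] refl sum.cong) (simp_all add: m'_def)
    also have "\<dots> = F u"
    proof (cases "u = s")
      case True
      then show ?thesis by (simp add: m'_def)
    next
      case False
      then have "\<not> (\<forall>j. s $ j \<le> u $ j)"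
        using s(2)[OF u] by (auto simp: less_eq_vec_def)
      then show ?thesis using m u False by auto
    qed
    finally show ?thesis by simp
  qed
  then show ?case by blast
qed auto

lemma half_open_box_nonempty:
  assumes "\<And>j. x $ j < y $ j" shows "y \<in> half_open_box x y"
  using assms by (simp add: half_open_box_def)

definition box_repr :: "(real ^ 'n) set \<Rightarrow> (real ^ 'n) \<times> (real ^ 'n) \<Rightarrow> bool" where
  "box_repr R z \<longleftrightarrow> fst z \<in> unit_cube \<and> snd z \<in> unit_cube \<and> (\<forall>j. fst z $ j < snd z $ j)
     \<and> R = half_open_box (fst z) (snd z)"

lemma box_repr_ex: "R \<in> half_open_boxes \<longleftrightarrow> (\<exists>z. box_repr R z)"
  by (auto simp: half_open_boxes_def box_repr_def)

lemma half_open_box_inj: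
  fixes x y x' y' :: "real ^ 'n"
  assumes xy: "\<And>j. x $ j < y $ j" and xy': "\<And>j. x' $ j < y' $ j"
    and eq: "half_open_box x y = half_open_box x' y'"
  shows "x = x' \<and> y = y'"
proof -
  have sub: "x' $ j \<le> x $ j \<and> y $ j \<le> y' $ j"
    if "half_open_box x y \<subseteq> half_open_box x' y'" "\<And>j. x $ j < y $ j"
    for x y x' y' :: "real ^ 'n" and j
  proof -
    have 1: "y \<in> half_open_box x' y'" using half_open_box_nonempty[OF that(2)] that(1) by blast
    have "x' $ j \<le> x $ j"
    proof (rule ccontr)
      assume "\<not> x' $ j \<le> x $ j"
      then have *: "x $ j < x' $ j" by simp
      have "x' $ j < y $ j" using 1 by (simp add: half_open_box_def)
      then have "(\<chi> k. if k = j then x' $ j else y $ k) \<in> half_open_box x y"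
        using * that(2) by (auto simp: half_open_box_def)
      then have "(\<chi> k. if k = j then x' $ j else y $ k) \<in> half_open_box x' y'"
        using that(1) by blast
      then show False unfolding half_open_box_def by (auto dest: spec[of _ j])
    qed
    then show ?thesis using 1 by (simp add: half_open_box_def)
  qed
  show ?thesis
    using sub[OF eq[THEN equalityD1] xy] sub[OF eq[THEN equalityD2] xy']
    unfolding vec_eq_iff by (meson order_antisym)
qed

definition set_volume :: "(real ^ 'n \<Rightarrow> real) \<Rightarrow> (real ^ 'n) set \<Rightarrow> real" where
  "set_volume Q R = (let z = (SOME z. box_repr R z) in box_volume Q (fst z) (snd z))"

lemma set_volume_box:
  fixes x y :: "real ^ 'n"
  assumes "x \<in> unit_cube" "y \<in> unit_cube" "\<And>j. x $ j < y $ j"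
  shows "set_volume Q (half_open_box x y) = box_volume Q x y"
proof -
  have "box_repr (half_open_box x y) (x, y)" using assms by (simp add: box_repr_def)
  then have r: "box_repr (half_open_box x y) (SOME z. box_repr (half_open_box x y) z)"
    by (rule someI)
  then have "x = fst (SOME z. box_repr (half_open_box x y) z)
      \<and> y = snd (SOME z. box_repr (half_open_box x y) z)"
    unfolding box_repr_def using assms by (intro half_open_box_inj) auto
  then show ?thesis by (simp add: set_volume_def Let_def)
qed

lemma sum_volume_point_masses:
  fixes Q :: "real ^ 'n \<Rightarrow> real"
  assumes "finite \<R>" "\<R> \<subseteq> half_open_boxes"
  shows "\<exists>S m. finite S \<and> (\<forall>P\<subseteq>\<R>. disjoint P \<longrightarrow> (\<Sum>R\<in>P. set_volume Q R) = (\<Sum>g\<in>S. m g * of_bool (g \<in> \<Union>P)))"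
proof -
  obtain z where z: "\<And>R. R \<in> \<R> \<Longrightarrow> box_repr R (z R)"
    using assms(2) box_repr_ex by (metis subsetD)
  define S where "S = (\<Union>R\<in>\<R>. {v. \<forall>j. v $ j \<in> {fst (z R) $ j, snd (z R) $ j}})"
  have fin: "finite S" unfolding S_def using assms(1) finite_box_vertices by blast
  obtain m where m: "\<And>u. u \<in> S \<Longrightarrow> Q u = (\<Sum>g\<in>S. m g * of_bool (\<forall>j. g $ j \<le> u $ j))"
    using point_masses[OF fin, of Q] by blast
  have vol: "set_volume Q R = (\<Sum>g\<in>S. m g * of_bool (g \<in> R))" if R: "R \<in> \<R>" for R
  proof -
    obtain x y where xy: "z R = (x, y)" by fastforce
    have b: "x \<in> unit_cube" "y \<in> unit_cube" "\<And>j. x $ j < y $ j" "R = half_open_box x y"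
      using z[OF R] by (auto simp: box_repr_def xy)
    have sub: "{v. \<forall>j. v $ j \<in> {x $ j, y $ j}} \<subseteq> S"
    proof
      fix v assume "v \<in> {v. \<forall>j. v $ j \<in> {x $ j, y $ j}}"
      then have "v \<in> {v. \<forall>j. v $ j \<in> {fst (z R) $ j, snd (z R) $ j}}" by (simp add: xy)
      then show "v \<in> S" unfolding S_def using R by blast
    qed
    have "set_volume Q R = box_volume Q x y" using set_volume_box b by metis
    also have "\<dots> = (\<Sum>v\<in>{v. \<forall>j. v $ j \<in> {x $ j, y $ j}}.
        \<Sum>g\<in>S. m g * (box_sign x v * of_bool (\<forall>j. g $ j \<le> v $ j)))"
      unfolding box_volume_def using sub
      by (intro sum.cong refl, subst m) (auto simp: sum_distrib_left mult_ac)
    also have "\<dots> = (\<Sum>g\<in>S. m g * box_volume (\<lambda>u. of_bool (\<forall>j. g $ j \<le> u $ j)) x y)"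
      unfolding box_volume_def sum_distrib_left by (rule sum.swap)
    also have "\<dots> = (\<Sum>g\<in>S. m g * of_bool (g \<in> R))"
      using box_volume_step[of x y] b by simp
    finally show ?thesis .
  qed
  have "(\<Sum>R\<in>P. set_volume Q R) = (\<Sum>g\<in>S. m g * of_bool (g \<in> \<Union>P))"
    if P: "P \<subseteq> \<R>" "disjoint P" for P
  proof -
    have "(\<Sum>R\<in>P. set_volume Q R) = (\<Sum>R\<in>P. \<Sum>g\<in>S. m g * of_bool (g \<in> R))"
      using P vol by (intro sum.cong) auto
    also have "\<dots> = (\<Sum>g\<in>S. \<Sum>R\<in>P. m g * of_bool (g \<in> R))" by (rule sum.swap)
    also have "\<dots> = (\<Sum>g\<in>S. m g * of_bool (g \<in> \<Union>P))"
    proof (rule sum.cong[OF refl])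
      fix g
      have finP: "finite P" using P(1) assms(1) finite_subset by blast
      show "(\<Sum>R\<in>P. m g * of_bool (g \<in> R)) = m g * of_bool (g \<in> \<Union>P)"
      proof (cases "g \<in> \<Union>P")
        case True
        then obtain R where R: "R \<in> P" "g \<in> R" by blast
        have "g \<notin> R'" if "R' \<in> P - {R}" for R'
          using disjointD[OF P(2) R(1), of R'] that R(2) by blast
        then have "(\<Sum>R\<in>P - {R}. m g * of_bool (g \<in> R)) = 0" by (intro sum.neutral) auto
        then show ?thesis using sum.remove[OF finP R(1), of "\<lambda>R. m g * of_bool (g \<in> R)"] R True by simp
      qed (auto intro!: sum.neutral)
    qed
    finally show ?thesis .
  qed
  then show ?thesis using fin by blast
qed

lemma sum_volume_unique:
  assumes "finite P" "P \<subseteq> half_open_boxes" "disjoint P"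
    and "finite P'" "P' \<subseteq> half_open_boxes" "disjoint P'" and "\<Union>P = \<Union>P'"
  shows "(\<Sum>R\<in>P. set_volume Q R) = (\<Sum>R\<in>P'. set_volume Q R)"
proof -
  have "finite (P \<union> P')" "P \<union> P' \<subseteq> half_open_boxes" using assms by auto
  then obtain S m where
    "\<And>P''. P'' \<subseteq> P \<union> P' \<Longrightarrow> disjoint P'' \<Longrightarrow>
       (\<Sum>R\<in>P''. set_volume Q R) = (\<Sum>g\<in>S. m g * of_bool (g \<in> \<Union>P''))"
    using sum_volume_point_masses by blast
  from this[of P] this[of P'] show ?thesis using assms by simp
qed

lemma half_open_boxes_algebra:
  assumes "R \<in> half_open_boxes" shows "R \<in> box_algebra"
  using assms by (force simp: box_algebra_def intro!: exI[of _ "{R}"])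

lemma empty_notin_half_open_boxes: "{} \<notin> half_open_boxes"
  using half_open_box_nonempty by (force simp: half_open_boxes_def)

lemma disjoint_Un_box:
  assumes "disjoint P" "disjoint P'" "\<Union>P \<inter> \<Union>P' = {}"
  shows "disjoint (P \<union> P')"
  using assms by (intro disjoint_union) auto

lemma ex_induced_measure:
  fixes Q :: "real ^ 'n \<Rightarrow> real"
  shows "\<exists>\<mu>. is_induced_measure Q \<mu>"
proof -
  define part where "part E P \<longleftrightarrow> finite P \<and> P \<subseteq> half_open_boxes \<and> disjoint P \<and> E = \<Union>P"
    for E :: "(real ^ 'n) set" and P
  define \<mu> where "\<mu> = (\<lambda>E\<in>box_algebra. \<Sum>R\<in>(SOME P. part E P). set_volume Q R)"
  have alg: "E \<in> box_algebra \<longleftrightarrow> (\<exists>P. part E P)" for E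
    by (auto simp: box_algebra_def part_def)
  have mu: "\<mu> E = (\<Sum>R\<in>P. set_volume Q R)" if "part E P" for E P
  proof -
    have "part E (SOME P. part E P)" using that by (rule someI)
    then have "(\<Sum>R\<in>(SOME P. part E P). set_volume Q R) = (\<Sum>R\<in>P. set_volume Q R)"
      using that unfolding part_def by (intro sum_volume_unique) auto
    then show ?thesis using that alg by (auto simp: \<mu>_def)
  qed
  have "additive box_algebra \<mu>"
    unfolding additive_def
  proof (intro ballI impI)
    fix E F :: "(real ^ 'n) set"
    assume "E \<in> box_algebra" "F \<in> box_algebra" and EF: "E \<inter> F = {}"
    then obtain P P' where P: "part E P" "part F P'" using alg by blast
    have un: "part (E \<union> F) (P \<union> P')"
      using P EF disjoint_Un_box[of P P'] by (auto simp: part_def)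
    have "P \<inter> P' = {}"
    proof (rule ccontr)
      assume "P \<inter> P' \<noteq> {}"
      then obtain R where R: "R \<in> P" "R \<in> P'" by blast
      then have "R \<noteq> {}" using P empty_notin_half_open_boxes by (auto simp: part_def)
      then show False using R P EF by (auto simp: part_def)
    qed
    then show "\<mu> (E \<union> F) = \<mu> E + \<mu> F"
      using mu[OF un] mu[OF P(1)] mu[OF P(2)] P by (simp add: part_def sum.union_disjoint)
  qed
  moreover have "\<mu> (half_open_box x y) = box_volume Q x y"
    if "x \<in> unit_cube" "y \<in> unit_cube" "\<forall>j. x $ j < y $ j" for x y
  proof -
    have "part (half_open_box x y) {half_open_box x y}"
      using that by (auto simp: part_def half_open_boxes_def)
    then show ?thesis using mu set_volume_box that by fastforce
  qed
  ultimately have "is_induced_measure Q \<mu>"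
    by (auto simp: is_induced_measure_def \<mu>_def)
  then show ?thesis by (rule exI[of _ \<mu>])
qed

lemma induced_measure_sum:
  assumes "is_induced_measure Q \<mu>" "finite P" "P \<subseteq> half_open_boxes" "disjoint P"
  shows "\<mu> (\<Union>P) = (\<Sum>R\<in>P. set_volume Q R)"
  using assms(2-)
proof (induction P rule: finite_induct)
  case empty
  have "{} \<in> box_algebra" by (auto simp: box_algebra_def intro!: exI[of _ "{}"])
  then have "\<mu> ({} \<union> {}) = \<mu> {} + \<mu> {}"
    using assms(1) unfolding is_induced_measure_def additive_def by blast
  then show ?case by simp
next
  case (insert R P)
  have dP: "disjoint P" using insert.prems(2) by (auto simp: disjoint_def)
  have "R \<in> box_algebra" using half_open_boxes_algebra insert.prems by blast
  moreover have "\<Union>P \<in> box_algebra" using insert dP by (auto simp: box_algebra_def)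
  moreover have "R \<inter> \<Union>P = {}"
    using insert.hyps(2) disjointD[OF insert.prems(2), of R] by blast
  ultimately have "\<mu> (R \<union> \<Union>P) = \<mu> R + \<mu> (\<Union>P)"
    using assms(1) unfolding is_induced_measure_def additive_def by blast
  moreover have "\<mu> R = set_volume Q R"
  proof -
    obtain x y where xy: "x \<in> unit_cube" "y \<in> unit_cube" "\<And>j. x $ j < y $ j" "R = half_open_box x y"
      using insert.prems(1) by (auto simp: half_open_boxes_def)
    then have "\<mu> R = box_volume Q x y"
      using assms(1) by (simp add: is_induced_measure_def)
    then show ?thesis using set_volume_box[OF xy(1-3)] xy(4) by simp
  qed
  ultimately show ?case using insert dP by simp
qed

theorem ex1_induced_measure:
  fixes Q :: "real ^ 'n \<Rightarrow> real"
  shows "\<exists>!\<mu>. is_induced_measure Q \<mu>"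
proof (rule ex_ex1I[OF ex_induced_measure])
  fix \<mu> \<nu> assume *: "is_induced_measure Q \<mu>" "is_induced_measure Q \<nu>"
  show "\<mu> = \<nu>"
  proof (rule extensionalityI[of _ box_algebra])
    fix E :: "(real ^ 'n) set" assume "E \<in> box_algebra"
    then show "\<mu> E = \<nu> E"
      using induced_measure_sum[OF *(1)] induced_measure_sum[OF *(2)] by (auto simp: box_algebra_def)
  qed (use * in \<open>auto simp: is_induced_measure_def\<close>)
qed

end

theory Submission
  imports Defs
begin

text \<open>
  Given a quasi-copula \<open>A\<close> and a large number \<open>m\<close>, put \<open>m\<close> copies of \<open>A\<close>, shrunk by the factor
  \<open>m\<close>, along the main diagonal of the cube. The resulting ordinal sum \<open>Q\<close> is a quasi-copula within
  \<open>1 / m\<close> of \<open>M\<close> (\<open>coord_average_close_to_min\<close>), since its mass lies in the diagonal blocks and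
  every block carries total mass \<open>1 / m\<close>, whatever the signs inside it.

  Now cut each of the \<open>m\<close> blocks \<open>((l, l + 1] / m)\<close> of every axis into \<open>m\<close> equal pieces and sort the
  \<open>m\<^sup>2\<close> pieces by their position \<open>i\<close> within the block first and by the block \<open>l\<close> second; this is the
  transposition of an \<open>m \<times> m\<close> array of pieces. The copies of \<open>A\<close> are thereby interleaved: each is
  spread over the entire cube, and its \<open>i\<close>-th layers end up in the \<open>i\<close>-th layers of the cube.
  The shuffle \<open>S\<close> of \<open>Q\<close> is thus the average of the functions \<open>A \<circ> h\<^sub>l\<close>, where \<open>h\<^sub>l\<close> acts
  coordinatewise and displaces every coordinate by at most \<open>1 / m\<close>. By the Lipschitz condition,
  \<open>S\<close> is within \<open>d / m\<close> of \<open>A\<close> (\<open>coord_average_close_to_self\<close>).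

  Both \<open>Q\<close> and \<open>S\<close> are averages of \<open>A\<close> over coordinatewise increasing reparametrizations
  of \<open>[0, 1]\<close> whose mean is the identity, and every such average is again a quasi-copula
  (\<open>coord_average_quasi_copula\<close>): the mean condition provides both the uniform margins and the
  Lipschitz constant \<open>1\<close>.

  To see that \<open>S\<close> is indeed the shuffle of \<open>Q\<close> (\<open>interleaving_is_shuffle\<close>), the measure induced by
  \<open>Q\<close> is written as the average of the pullbacks of the measure induced by \<open>A\<close> to the blocks
  (\<open>induced_measure_ordinal_sum\<close>). On each block the shuffle is strictly increasing in every coordinate,
  so the preimage of a box with a vertex at the origin is, seen from one block, again such a box.
\<close>

section \<open>Elementary properties of quasi-copulas\<close>

lemma quasi_copula_margin:
  assumes "A \<in> quasi_copulas" "t \<in> {0..1}"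
  shows "A (\<chi> k. if k = j then t else 1) = t"
  using assms by (auto simp: quasi_copulas_def)

lemma quasi_copula_lipschitz:
  assumes "A \<in> quasi_copulas" "u \<in> unit_cube" "v \<in> unit_cube"
  shows "\<bar>A v - A u\<bar> \<le> (\<Sum>j\<in>UNIV. \<bar>v $ j - u $ j\<bar>)"
  using assms by (auto simp: quasi_copulas_def)

lemma quasi_copula_mono_coord:
  assumes "A \<in> quasi_copulas" "u \<in> unit_cube" "u $ j \<le> t" "t \<le> 1"
  shows "A u \<le> A (\<chi> k. if k = j then t else u $ k)"
  using assms by (auto simp: quasi_copulas_def)

lemma quasi_copula_mono:
  fixes u v :: "real ^ 'n"
  assumes A: "A \<in> quasi_copulas" and u: "u \<in> unit_cube" and v: "v \<in> unit_cube"
    and uv: "\<And>k. u $ k \<le> v $ k"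
  shows "A u \<le> A v"
proof -
  \<comment> \<open>Raise the coordinates one after the other; \<open>F\<close> collects those already raised.\<close>
  have "A u \<le> A (\<chi> k. if k \<in> F then v $ k else u $ k)" if "finite F" for F
    using that
  proof (induction F rule: finite_induct)
    case (insert j F)
    let ?w = "(\<chi> k. if k \<in> F then v $ k else u $ k)"
    have "A ?w \<le> A (\<chi> k. if k = j then v $ j else ?w $ k)"
      using u v uv by (intro quasi_copula_mono_coord[OF A]) (auto simp: unit_cube_def)
    also have "(\<chi> k. if k = j then v $ j else ?w $ k) = (\<chi> k. if k \<in> insert j F then v $ k else u $ k)"
      by (auto simp: vec_eq_iff)
    finally show ?case using insert.IH by linarith
  qed simp
  from this[of UNIV] show ?thesis by simp
qed

lemma quasi_copula_le_coord:
  fixes u :: "real ^ 'n"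
  assumes A: "A \<in> quasi_copulas" and u: "u \<in> unit_cube"
  shows "A u \<le> u $ j"
proof -
  have "A u \<le> A (\<chi> k. if k = j then u $ j else 1)"
    using u by (intro quasi_copula_mono[OF A u]) (auto simp: unit_cube_def)
  then show ?thesis using quasi_copula_margin[OF A, of "u $ j" j] u by (auto simp: unit_cube_def)
qed

lemma quasi_copula_grounded:
  assumes "A \<in> quasi_copulas" "u \<in> unit_cube" "u $ j = 0"
  shows "A u = 0"
  using quasi_copula_le_coord[OF assms(1,2), of j] quasi_copula_range[OF assms(1,2)] assms(3) by simp

lemma quasi_copula_ones:
  fixes A :: "real ^ 'n \<Rightarrow> real"
  assumes "A \<in> quasi_copulas"
  shows "A (\<chi> k. 1) = 1"
  using quasi_copula_margin[OF assms, of 1] by (simp cong: if_cong)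


section \<open>Averages of reparametrized quasi-copulas\<close>

text \<open>
  The map \<open>f\<close> applied to each coordinate; all reparametrizations below treat all coordinates alike.
\<close>

definition coord_map :: "(real \<Rightarrow> real) \<Rightarrow> real ^ 'n \<Rightarrow> real ^ 'n" where
  "coord_map f u = (\<chi> k. f (u $ k))"

lemma coord_map_nth [simp]: "coord_map f u $ k = f (u $ k)"
  by (simp add: coord_map_def)

definition coord_average ::
  "nat \<Rightarrow> (nat \<Rightarrow> real \<Rightarrow> real) \<Rightarrow> (real ^ 'n \<Rightarrow> real) \<Rightarrow> real ^ 'n \<Rightarrow> real" where
  "coord_average m f A = (\<lambda>u\<in>unit_cube. (\<Sum>l<m. A (coord_map (f l) u)) / real m)"

definition mean_identity :: "nat \<Rightarrow> (nat \<Rightarrow> real \<Rightarrow> real) \<Rightarrow> bool" where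
  "mean_identity m f \<longleftrightarrow> m > 0 \<and>
     (\<forall>l<m. mono (f l) \<and> f l 1 = 1 \<and> (\<forall>t\<in>{0..1}. f l t \<in> {0..1})) \<and>
     (\<forall>t\<in>{0..1}. (\<Sum>l<m. f l t) = real m * t)"

lemma coord_map_unit_cube:
  assumes "\<And>t. t \<in> {0..1} \<Longrightarrow> f t \<in> {0..1}" "u \<in> unit_cube"
  shows "coord_map f u \<in> unit_cube"
  using assms by (auto simp: unit_cube_def)

text \<open>
  In the direction of the \<open>j\<close>-th axis, the \<open>l\<close>-th summand changes by at most the increment of
  \<open>f l\<close>. Since all \<open>f l\<close> are increasing, these increments have the same sign, and averaging
  them without cancellation gives the increment of the mean of the \<open>f l\<close>, that is, of the identity.
\<close>

lemma coord_average_quasi_copula: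
  fixes A :: "real ^ 'n \<Rightarrow> real"
  assumes A: "A \<in> quasi_copulas" and f: "mean_identity m f"
  shows "coord_average m f A \<in> quasi_copulas"
proof -
  note [simp] = coord_average_def
  have m: "m > 0" and mono: "\<And>l s t. l < m \<Longrightarrow> s \<le> t \<Longrightarrow> f l s \<le> f l t"
    and one: "\<And>l. l < m \<Longrightarrow> f l 1 = 1"
    and mean: "\<And>t. t \<in> {0..1} \<Longrightarrow> (\<Sum>l<m. f l t) = real m * t"
    using f by (auto simp: mean_identity_def dest: monoD)
  have cube: "coord_map (f l) u \<in> unit_cube" if "l < m" "u \<in> unit_cube" for l and u :: "real ^ 'n"
    using that f by (intro coord_map_unit_cube) (auto simp: mean_identity_def)
  have 1: "coord_average m f A \<in> unit_cube \<rightarrow>\<^sub>E {0..1}"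
  proof (rule PiE_I)
    fix u :: "real ^ 'n" assume u: "u \<in> unit_cube"
    have "0 \<le> (\<Sum>l<m. A (coord_map (f l) u))"
      using quasi_copula_range[OF A cube[OF _ u]] by (intro sum_nonneg) auto
    moreover have "(\<Sum>l<m. A (coord_map (f l) u)) \<le> (\<Sum>l<m. 1)"
      using quasi_copula_range[OF A cube[OF _ u]] by (intro sum_mono) auto
    ultimately show "coord_average m f A u \<in> {0..1}" using m u by (simp add: divide_simps)
  qed simp
  have 2: "coord_average m f A (\<chi> k. if k = j then t else 1) = t" if t: "t \<in> {0..1}" for t j
  proof -
    have "A (coord_map (f l) (\<chi> k. if k = j then t else 1)) = f l t" if l: "l < m" for l
    proof -
      have "coord_map (f l) (\<chi> k. if k = j then t else 1) = (\<chi> k. if k = j then f l t else 1)"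
        using one[OF l] by (auto simp: vec_eq_iff)
      then show ?thesis using quasi_copula_margin[OF A, of "f l t" j] f l t by (auto simp: mean_identity_def)
    qed
    moreover have "(\<chi> k. if k = j then t else 1) \<in> unit_cube" using t by (auto simp: unit_cube_def)
    ultimately show ?thesis using mean[OF t] m by simp
  qed
  have 3: "coord_average m f A u \<le> coord_average m f A (\<chi> k. if k = j then t else u $ k)"
    if u: "u \<in> unit_cube" and t: "u $ j \<le> t" "t \<le> 1" for u j t
  proof -
    have v: "(\<chi> k. if k = j then t else u $ k) \<in> unit_cube"
      using u t by (auto simp: unit_cube_def intro: order_trans)
    have "A (coord_map (f l) u) \<le> A (coord_map (f l) (\<chi> k. if k = j then t else u $ k))" if l: "l < m" for l
      using t mono[OF l] by (intro quasi_copula_mono[OF A cube[OF l u] cube[OF l v]]) auto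
    then have "(\<Sum>l<m. A (coord_map (f l) u)) \<le> (\<Sum>l<m. A (coord_map (f l) (\<chi> k. if k = j then t else u $ k)))"
      by (intro sum_mono) auto
    then show ?thesis using u v m by (simp add: divide_right_mono)
  qed
  have 4: "\<bar>coord_average m f A v - coord_average m f A u\<bar> \<le> (\<Sum>j\<in>UNIV. \<bar>v $ j - u $ j\<bar>)"
    if u: "u \<in> unit_cube" and v: "v \<in> unit_cube" for u v
  proof -
    have one_coord: "(\<Sum>l<m. \<bar>f l (v $ j) - f l (u $ j)\<bar>) = real m * \<bar>v $ j - u $ j\<bar>" for j
    proof -
      have *: "u $ j \<in> {0..1}" "v $ j \<in> {0..1}" using u v by (auto simp: unit_cube_def)
      \<comment> \<open>All terms have the same sign because all the maps are increasing.\<close>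
      have "(\<Sum>l<m. \<bar>f l (v $ j) - f l (u $ j)\<bar>) = (\<Sum>l<m. sgn (v $ j - u $ j) * (f l (v $ j) - f l (u $ j)))"
      proof (rule sum.cong)
        fix l assume "l \<in> {..<m}"
        then show "\<bar>f l (v $ j) - f l (u $ j)\<bar> = sgn (v $ j - u $ j) * (f l (v $ j) - f l (u $ j))"
          using mono[of l "u $ j" "v $ j"] mono[of l "v $ j" "u $ j"] by (auto simp: sgn_real_def)
      qed simp
      also have "\<dots> = sgn (v $ j - u $ j) * (real m * (v $ j - u $ j))"
        by (simp add: mean[OF *(1)] mean[OF *(2)] sum_subtractf right_diff_distrib[of "real m"]
            flip: sum_distrib_left)
      finally show ?thesis by (auto simp: sgn_real_def)
    qed
    have "\<bar>(\<Sum>l<m. A (coord_map (f l) v)) - (\<Sum>l<m. A (coord_map (f l) u))\<bar>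
        \<le> (\<Sum>l<m. \<bar>A (coord_map (f l) v) - A (coord_map (f l) u)\<bar>)"
      by (simp add: sum_abs flip: sum_subtractf)
    also have "\<dots> \<le> (\<Sum>l<m. \<Sum>j\<in>UNIV. \<bar>f l (v $ j) - f l (u $ j)\<bar>)"
      using quasi_copula_lipschitz[OF A cube[OF _ u] cube[OF _ v]] by (intro sum_mono) simp
    also have "\<dots> = real m * (\<Sum>j\<in>UNIV. \<bar>v $ j - u $ j\<bar>)"
      by (subst sum.swap) (simp add: one_coord sum_distrib_left)
    finally show ?thesis using m u v by (simp add: field_simps flip: diff_divide_distrib)
  qed
  show ?thesis unfolding quasi_copulas_def using 1 2 3 4 by blast
qed

definition clip :: "real \<Rightarrow> real" where
  "clip z = max 0 (min 1 z)"

lemma clip_mono: "a \<le> b \<Longrightarrow> clip a \<le> clip b"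
  by (simp add: clip_def)

text \<open>
  The functions \<open>\<lambda>y. clip (y - j)\<close> climb one after the other, each over a unit interval. Both
  families of reparametrizations below are built from them, and this is why their means are the identity.
\<close>

lemma sum_clip: "(\<Sum>j<n. clip (y - real j)) = max 0 (min (real n) y)"
  by (induction n) (auto simp: clip_def)

text \<open>
  The position within the \<open>l\<close>-th of \<open>m\<close> equal blocks, rescaled to \<open>[0, 1]\<close>. Accordingly
  \<open>coord_average m (ordinal_coord m) A\<close> is the ordinal sum of \<open>m\<close> copies of \<open>A\<close>.
\<close>

definition ordinal_coord :: "nat \<Rightarrow> nat \<Rightarrow> real \<Rightarrow> real" where
  "ordinal_coord m l t = clip (real m * t - real l)"

text \<open>
  The fraction of the \<open>l\<close>-th copy of \<open>A\<close> that is to the left of \<open>x\<close> after interleaving: the piece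
  with number \<open>i\<close> of this copy then occupies the interval \<open>(i m + l, i m + l + 1] / m\<^sup>2\<close>.
\<close>

definition interleaved_coord :: "nat \<Rightarrow> nat \<Rightarrow> real \<Rightarrow> real" where
  "interleaved_coord m l x = (\<Sum>i<m. clip (real (m * m) * x - real (i * m + l))) / real m"

lemma mean_identity_ordinal_coord:
  assumes m: "m > 0"
  shows "mean_identity m (ordinal_coord m)"
  unfolding mean_identity_def
proof (intro conjI allI impI ballI)
  fix l assume "l < m"
  show "mono (ordinal_coord m l)"
  proof (rule monoI)
    fix x y :: real assume "x \<le> y"
    then show "ordinal_coord m l x \<le> ordinal_coord m l y" unfolding ordinal_coord_def
      by (intro clip_mono diff_right_mono mult_left_mono) auto
  qed
  show "ordinal_coord m l 1 = 1" using \<open>l < m\<close> by (simp add: ordinal_coord_def clip_def)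
  show "ordinal_coord m l t \<in> {0..1}" for t by (auto simp: ordinal_coord_def clip_def)
next
  fix t :: real assume t: "t \<in> {0..1}"
  then show "(\<Sum>l<m. ordinal_coord m l t) = real m * t"
    by (simp add: ordinal_coord_def sum_clip mult_left_le)
qed (use m in auto)

text \<open>
  Each of the \<open>m\<close> layers of the cube contains exactly one piece of each copy, so that up to \<open>x\<close>
  there are at least as many pieces of the \<open>l\<close>-th copy as completed layers, and at most one more.
\<close>

lemma interleaved_coord_close:
  assumes l: "l < m" and x: "x \<in> {0..1}"
  shows "\<bar>interleaved_coord m l x - x\<bar> \<le> 1 / real m"
proof -
  have m: "m > 0" using l by simp
  have *: "clip (real m * x - 1 - real i) \<le> clip (real (m * m) * x - real (i * m + l))
      \<and> clip (real (m * m) * x - real (i * m + l)) \<le> clip (real m * x + 1 - real i)" for i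
  proof -
    define y where "y = real m * x - real i"
    have e: "real (m * m) * x - real (i * m + l) = real m * y - real l"
      by (simp add: y_def algebra_simps)
    have 1: "real m * y - real l \<ge> 1" if "y \<ge> 1"
    proof -
      have "real m * 1 \<le> real m * y" using that by (intro mult_left_mono) auto
      then show ?thesis using l by linarith
    qed
    have 2: "real m * y - real l \<le> 0" if "y \<le> 0"
      using mult_nonneg_nonpos[of "real m" y] that by simp
    \<comment> \<open>The \<open>l\<close>-th piece of layer \<open>i\<close> is filled when the layer is completed (\<open>y \<ge> 1\<close>) and
      empty before the layer begins (\<open>y \<le> 0\<close>).\<close>
    show ?thesis unfolding e using 1 2 by (cases "y \<ge> 1"; cases "y \<le> 0") (auto simp: clip_def y_def)
  qed
  have "(\<Sum>i<m. clip (real m * x - 1 - real i)) \<le> real m * interleaved_coord m l x"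
    using * m by (simp add: interleaved_coord_def sum_mono)
  then have lo: "real m * x - 1 \<le> real m * interleaved_coord m l x"
    using mult_left_le[of x "real m"] x unfolding sum_clip by (auto simp: max_def min_def split: if_splits)
  have "real m * interleaved_coord m l x \<le> (\<Sum>i<m. clip (real m * x + 1 - real i))"
    using * m by (simp add: interleaved_coord_def sum_mono)
  then have hi: "real m * interleaved_coord m l x \<le> real m * x + 1"
    using x mult_nonneg_nonneg[of "real m" x] unfolding sum_clip by (auto simp: max_def min_def split: if_splits)
  have "\<bar>real m * (interleaved_coord m l x - x)\<bar> \<le> 1"
    using lo hi by (simp add: algebra_simps abs_le_iff)
  then have "real m * \<bar>interleaved_coord m l x - x\<bar> \<le> 1" by (simp only: abs_mult abs_of_nat)
  then show ?thesis using m by (simp add: pos_le_divide_eq mult.commute)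
qed

lemma mean_identity_interleaved_coord:
  assumes m: "m > 0"
  shows "mean_identity m (interleaved_coord m)"
  unfolding mean_identity_def
proof (intro conjI allI impI ballI)
  fix l assume l: "l < m"
  show "mono (interleaved_coord m l)"
  proof (rule monoI)
    fix x y :: real assume "x \<le> y"
    then show "interleaved_coord m l x \<le> interleaved_coord m l y" unfolding interleaved_coord_def
      by (intro divide_right_mono sum_mono clip_mono diff_right_mono mult_left_mono) auto
  qed
  have "clip (real (m * m) * 1 - real (i * m + l)) = 1" if "i < m" for i
  proof -
    have "Suc i * m \<le> m * m" using that by (intro mult_le_mono) auto
    then have "i * m + l + 1 \<le> m * m" using l by simp
    then have "real (i * m + l + 1) \<le> real (m * m)" by (simp only: of_nat_le_iff)
    then show ?thesis by (simp add: clip_def)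
  qed
  then show "interleaved_coord m l 1 = 1" using m by (simp add: interleaved_coord_def)
  fix t :: real
  have "0 \<le> (\<Sum>i<m. clip (real (m * m) * t - real (i * m + l)))"
    by (intro sum_nonneg) (simp add: clip_def)
  moreover have "(\<Sum>i<m. clip (real (m * m) * t - real (i * m + l))) \<le> (\<Sum>i<m. 1)"
    by (intro sum_mono) (simp add: clip_def)
  ultimately show "interleaved_coord m l t \<in> {0..1}" using m by (simp add: interleaved_coord_def)
next
  fix t :: real assume t: "t \<in> {0..1}"
  have "(\<Sum>l<m. interleaved_coord m l t)
      = (\<Sum>i<m. \<Sum>l<m. clip (real (m * m) * t - real (i * m + l))) / real m"
    unfolding interleaved_coord_def sum_divide_distrib[symmetric] by (subst sum.swap) simp
  \<comment> \<open>Division with remainder by \<open>m\<close> enumerates all \<open>m\<^sup>2\<close> pieces.\<close>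
  also have "(\<Sum>i<m. \<Sum>l<m. clip (real (m * m) * t - real (i * m + l)))
      = (\<Sum>j<m * m. clip (real (m * m) * t - real j))"
    by (subst sum.nat_group[symmetric])
      (simp add: sum.shift_bounds_nat_ivl[of _ 0, simplified] atLeast0LessThan sum.atLeastLessThan_shift_0 add.commute)
  also have "\<dots> = real (m * m) * t"
    unfolding sum_clip using t mult_left_le[of t "real (m * m)"] by simp
  finally show "(\<Sum>l<m. interleaved_coord m l t) = real m * t" using m by simp
qed (use m in auto)

text \<open>
  With \<open>t = M u\<close>, all coordinates of \<open>u\<close> are past the blocks that end before \<open>t\<close>. Each of these
  blocks contributes its full mass \<open>1 / m\<close>, and at most \<open>1 / m\<close> of \<open>t\<close> is outside of them. The
  other estimate is the upper Frechet bound \<open>Q \<le> M\<close>.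
\<close>

lemma coord_average_close_to_min:
  fixes A :: "real ^ 'n \<Rightarrow> real"
  assumes A: "A \<in> quasi_copulas" and m: "m > 0"
  shows "uniform_dist min_copula (coord_average m (ordinal_coord m) A) \<le> 1 / real m"
proof (rule uniform_dist_least[OF min_copula_quasi_copula])
  show Q: "coord_average m (ordinal_coord m) A \<in> quasi_copulas"
    by (rule coord_average_quasi_copula[OF A mean_identity_ordinal_coord[OF m]])
  fix u :: "real ^ 'n" assume u: "u \<in> unit_cube"
  define t where "t = min_copula u"
  have t: "t \<le> u $ k" for k using u by (simp add: t_def min_copula_def)
  have "t \<in> range (\<lambda>j. u $ j)" using u Min_in[of "range (\<lambda>j. u $ j)"] by (simp add: t_def min_copula_def)
  then obtain k where k: "t = u $ k" by blast
  have t01: "0 \<le> t" "t \<le> 1" using u k by (auto simp: unit_cube_def)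
  have *: "clip (real m * t - 1 - real l) \<le> A (coord_map (ordinal_coord m l) u)" if "l < m" for l
  proof (cases "real m * t - real l \<ge> 1")
    case True
    have "ordinal_coord m l (u $ k) = 1" for k
    proof -
      have "real m * t \<le> real m * u $ k" using t by (intro mult_left_mono) auto
      then show ?thesis using True by (simp add: ordinal_coord_def clip_def)
    qed
    then have "coord_map (ordinal_coord m l) u = (\<chi> k. 1)" by (simp add: vec_eq_iff)
    then show ?thesis using quasi_copula_ones[OF A] by (simp add: clip_def)
  next
    case False
    have "coord_map (ordinal_coord m l) u \<in> unit_cube"
      using u by (intro coord_map_unit_cube) (auto simp: ordinal_coord_def clip_def)
    then show ?thesis using quasi_copula_range[OF A] False by (auto simp: clip_def)
  qed
  have "real m * t - 1 \<le> (\<Sum>l<m. clip (real m * t - 1 - real l))"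
    using t01 mult_left_le[of t "real m"] unfolding sum_clip by (auto simp: max_def min_def)
  also have "\<dots> \<le> (\<Sum>l<m. A (coord_map (ordinal_coord m l) u))" using * by (intro sum_mono) auto
  also have "\<dots> = real m * coord_average m (ordinal_coord m) A u" using m u by (simp add: coord_average_def)
  finally have "t - 1 / real m \<le> coord_average m (ordinal_coord m) A u" using m by (simp add: field_simps)
  moreover have "coord_average m (ordinal_coord m) A u \<le> t"
    using quasi_copula_le_coord[OF Q u, of k] k by simp
  ultimately show "\<bar>min_copula u - coord_average m (ordinal_coord m) A u\<bar> \<le> 1 / real m"
    by (simp add: t_def)
qed

lemma coord_average_close_to_self:
  fixes A :: "real ^ 'n \<Rightarrow> real"
  assumes A: "A \<in> quasi_copulas" and m: "m > 0"
  shows "uniform_dist A (coord_average m (interleaved_coord m) A) \<le> real CARD('n) / real m"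
proof (rule uniform_dist_least[OF A])
  show Q: "coord_average m (interleaved_coord m) A \<in> quasi_copulas"
    by (rule coord_average_quasi_copula[OF A mean_identity_interleaved_coord[OF m]])
  fix u :: "real ^ 'n" assume u: "u \<in> unit_cube"
  have *: "\<bar>A u - A (coord_map (interleaved_coord m l) u)\<bar> \<le> real CARD('n) / real m" if l: "l < m" for l
  proof -
    have c: "coord_map (interleaved_coord m l) u \<in> unit_cube"
      using u mean_identity_interleaved_coord[OF m] l by (intro coord_map_unit_cube) (auto simp: mean_identity_def)
    have "\<bar>A u - A (coord_map (interleaved_coord m l) u)\<bar> \<le> (\<Sum>k\<in>UNIV. \<bar>interleaved_coord m l (u $ k) - u $ k\<bar>)"
      using quasi_copula_lipschitz[OF A c u] by (simp add: abs_minus_commute)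
    also have "\<dots> \<le> (\<Sum>k\<in>(UNIV :: 'n set). 1 / real m)"
      using interleaved_coord_close[OF l] u by (intro sum_mono) (auto simp: unit_cube_def)
    finally show ?thesis by simp
  qed
  have "\<bar>real m * A u - (\<Sum>l<m. A (coord_map (interleaved_coord m l) u))\<bar>
      = \<bar>\<Sum>l<m. A u - A (coord_map (interleaved_coord m l) u)\<bar>" by (simp add: sum_subtractf)
  also have "\<dots> \<le> (\<Sum>l<m. \<bar>A u - A (coord_map (interleaved_coord m l) u)\<bar>)" by (rule sum_abs)
  also have "\<dots> \<le> (\<Sum>l<m. real CARD('n) / real m)" using * by (intro sum_mono) auto
  finally have "\<bar>real m * A u - (\<Sum>l<m. A (coord_map (interleaved_coord m l) u))\<bar> \<le> real CARD('n)"
    using m by simp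
  moreover have "A u - coord_average m (interleaved_coord m) A u
      = (real m * A u - (\<Sum>l<m. A (coord_map (interleaved_coord m l) u))) / real m"
    using u m by (simp add: coord_average_def field_simps)
  ultimately show "\<bar>A u - coord_average m (interleaved_coord m) A u\<bar> \<le> real CARD('n) / real m"
    using m by (simp add: abs_divide divide_right_mono)
qed


section \<open>The measure induced by an ordinal sum\<close>

lemma box_sign_prod:
  fixes x v :: "real ^ 'n"
  shows "box_sign x v = (\<Prod>j\<in>UNIV. if v $ j = x $ j then - 1 else 1)"
  by (simp add: box_sign_def prod.If_cases minus_one_power_iff)

text \<open>
  The volume is determined by the vertices of the box, and these correspond to each other as long as
  \<open>f\<close> keeps the two ends of each side apart.
\<close>

lemma box_volume_coord_map:
  fixes x y :: "real ^ 'n"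
  assumes xy: "\<And>k. x $ k < y $ k" and lt: "\<And>k. f (x $ k) < f (y $ k)"
  shows "box_volume (\<lambda>v. A (coord_map f v)) x y = box_volume A (coord_map f x) (coord_map f y)"
  unfolding box_volume_def
proof (rule sum.reindex_bij_witness[where j = "coord_map f"
      and i = "\<lambda>w. \<chi> k. if w $ k = f (x $ k) then x $ k else y $ k"])
  fix v :: "real ^ 'n" assume "v \<in> {v. \<forall>j. v $ j \<in> {x $ j, y $ j}}"
  then have v: "\<And>j. v $ j = x $ j \<or> v $ j = y $ j" by auto
  have iff: "f (v $ k) = f (x $ k) \<longleftrightarrow> v $ k = x $ k" for k
    using v[of k] lt[of k] xy[of k] by auto
  show "(\<chi> k. if coord_map f v $ k = f (x $ k) then x $ k else y $ k) = v"
    by (simp add: vec_eq_iff iff) (use v in metis)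
  show "coord_map f v \<in> {v. \<forall>j. v $ j \<in> {coord_map f x $ j, coord_map f y $ j}}"
  proof (clarsimp)
    fix j assume "f (v $ j) \<noteq> f (y $ j)"
    then show "f (v $ j) = f (x $ j)" using v[of j] by auto
  qed
  show "box_sign (coord_map f x) (coord_map f v) * A (coord_map f v) = box_sign x v * A (coord_map f v)"
    by (simp add: box_sign_def iff)
next
  fix w :: "real ^ 'n" assume "w \<in> {v. \<forall>j. v $ j \<in> {coord_map f x $ j, coord_map f y $ j}}"
  then have w: "\<And>j. w $ j = f (x $ j) \<or> w $ j = f (y $ j)" by auto
  then show "coord_map f (\<chi> k. if w $ k = f (x $ k) then x $ k else y $ k) = w"
    by (simp add: vec_eq_iff) metis
  show "(\<chi> k. if w $ k = f (x $ k) then x $ k else y $ k) \<in> {v. \<forall>j. v $ j \<in> {x $ j, y $ j}}"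
    by auto
qed

text \<open>
  If \<open>f\<close> collapses the \<open>k\<close>-th side, then exchanging the two values of the \<open>k\<close>-th coordinate pairs
  vertices of opposite sign at which the function has the same value.
\<close>

lemma box_volume_coord_map_degenerate:
  fixes x y :: "real ^ 'n"
  assumes xy: "\<And>k. x $ k < y $ k" and eq: "f (x $ k) = f (y $ k)"
  shows "box_volume (\<lambda>v. A (coord_map f v)) x y = 0"
proof -
  define flip where "flip = (\<lambda>v :: real ^ 'n. \<chi> j. if j = k then (if v $ k = x $ k then y $ k else x $ k) else v $ j)"
  let ?V = "{v. \<forall>j. v $ j \<in> {x $ j, y $ j}}"
  have sgn: "box_sign x (flip v) = - box_sign x v" for v
    using xy[of k] unfolding box_sign_prod
    by (subst (1 2) prod.remove[of UNIV k]) (auto simp: flip_def intro!: prod.cong)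
  have val: "coord_map f (flip v) = coord_map f v" if "v \<in> ?V" for v
    using that eq by (auto simp: vec_eq_iff flip_def)
  have "(\<Sum>v\<in>?V. box_sign x v * A (coord_map f v)) = (\<Sum>v\<in>?V. - (box_sign x v * A (coord_map f v)))"
  proof (rule sum.reindex_bij_witness[of _ flip flip])
    fix v assume v: "v \<in> ?V"
    show "flip (flip v) = v" "flip v \<in> ?V"
      using v xy[of k] by (auto simp: flip_def vec_eq_iff)
    then show "flip (flip v) = v" "flip v \<in> ?V" by auto
    show "- (box_sign x (flip v) * A (coord_map f (flip v))) = box_sign x v * A (coord_map f v)"
      by (simp add: sgn val[OF v])
  qed
  then show ?thesis by (simp add: box_volume_def sum_negf)
qed

text \<open>
  All vertices but \<open>y\<close> lie on a face through the origin, where a quasi-copula vanishes.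
\<close>

lemma box_volume_from_zero:
  fixes y :: "real ^ 'n"
  assumes A: "A \<in> quasi_copulas" and y: "y \<in> unit_cube" "\<And>k. 0 < y $ k"
  shows "box_volume A 0 y = A y"
proof -
  let ?V = "{v. \<forall>j. v $ j \<in> {0 $ j, y $ j}} :: (real ^ 'n) set"
  have "box_volume A 0 y = (\<Sum>v\<in>?V. if v = y then A y else 0)"
    unfolding box_volume_def
  proof (rule sum.cong)
    fix v assume v: "v \<in> ?V"
    have c: "v \<in> unit_cube" unfolding unit_cube_def
    proof (clarify)
      fix j show "0 \<le> v $ j \<and> v $ j \<le> 1" using v y by (auto simp: unit_cube_def dest: spec[of _ j])
    qed
    show "box_sign 0 v * A v = (if v = y then A y else 0)"
    proof (cases "v = y")
      case True
      have "{j. y $ j = 0 $ j} = {}" using y(2) by (auto simp: less_imp_neq[symmetric])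
      then show ?thesis using True by (simp only: box_sign_def) simp
    next
      case False
      then obtain j where "v $ j \<noteq> y $ j" by (auto simp: vec_eq_iff)
      then have "v $ j = 0" using v by (auto dest: spec[of _ j])
      then show ?thesis using quasi_copula_grounded[OF A c] False by simp
    qed
  qed simp
  also have "\<dots> = A y" using finite_box_vertices[of 0 y] by (subst sum.delta) auto
  finally show ?thesis .
qed

lemma induced_measure_is: "is_induced_measure Q (induced_measure Q)"
  unfolding induced_measure_def by (rule theI'[OF ex1_induced_measure])

lemma induced_measure_eqI: "is_induced_measure Q \<mu> \<Longrightarrow> induced_measure Q = \<mu>"
  using ex1_induced_measure induced_measure_is by blast

lemma induced_measure_empty: "induced_measure Q {} = 0"
  using induced_measure_sum[OF induced_measure_is, of "{}"] by simp

lemma half_open_box_empty: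
  assumes "y $ k \<le> x $ k" shows "half_open_box x y = {}"
proof -
  have False if "u \<in> half_open_box x y" for u
  proof -
    have "x $ k < u $ k" "u $ k \<le> y $ k" using that by (auto simp: half_open_box_def)
    then show False using assms by simp
  qed
  then show ?thesis by blast
qed

lemma half_open_box_cases:
  fixes x y :: "real ^ 'n"
  assumes "x \<in> unit_cube" "\<And>k. y $ k \<le> 1"
  shows "half_open_box x y \<in> half_open_boxes \<or> half_open_box x y = {}"
proof (cases "\<forall>k. x $ k < y $ k")
  case True
  have "y \<in> unit_cube" unfolding unit_cube_def
  proof (clarify)
    fix j show "0 \<le> y $ j \<and> y $ j \<le> 1"
      using assms True[rule_format, of j] by (auto simp: unit_cube_def dest: spec[of _ j] intro: less_imp_le order.strict_trans1)
  qed
  then show ?thesis using True assms by (auto simp: half_open_boxes_def)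
next
  case False
  then obtain k where "y $ k \<le> x $ k" by (auto simp: not_less)
  then have "half_open_box x y = {}" by (rule half_open_box_empty)
  then show ?thesis by simp
qed

lemma induced_measure_from_zero:
  fixes y :: "real ^ 'n"
  assumes A: "A \<in> quasi_copulas" and y: "y \<in> unit_cube"
  shows "induced_measure A (half_open_box 0 y) = A y"
proof (cases "\<forall>k. 0 < y $ k")
  case True
  then have "induced_measure A (half_open_box 0 y) = box_volume A 0 y"
    using induced_measure_is[of A] y zero_in_unit_cube by (auto simp: is_induced_measure_def)
  then show ?thesis using box_volume_from_zero[OF A y] True by simp
next
  case False
  then obtain k where k: "y $ k = 0" using y by (auto simp: unit_cube_def not_less intro: order_antisym)
  then have "half_open_box 0 y = {}" by (intro half_open_box_empty[of _ k]) simp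
  then show ?thesis using quasi_copula_grounded[OF A y k] induced_measure_empty by simp
qed

lemma box_algebra_Un:
  assumes "E \<in> box_algebra" "F \<in> box_algebra" "E \<inter> F = {}"
  shows "E \<union> F \<in> box_algebra"
proof -
  obtain P P' where "finite P" "P \<subseteq> half_open_boxes" "disjoint P" "E = \<Union>P"
    "finite P'" "P' \<subseteq> half_open_boxes" "disjoint P'" "F = \<Union>P'"
    using assms by (auto simp: box_algebra_def)
  then show ?thesis using assms(3) disjoint_Un_box[of P P']
    by (auto simp: box_algebra_def intro!: exI[of _ "P \<union> P'"])
qed

lemma UN_in_box_algebra:
  assumes "finite I" "\<And>i. i \<in> I \<Longrightarrow> B i \<in> half_open_boxes \<or> B i = {}"
    and disj: "\<And>i j. i \<in> I \<Longrightarrow> j \<in> I \<Longrightarrow> i \<noteq> j \<Longrightarrow> B i \<inter> B j = {}"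
  shows "(\<Union>i\<in>I. B i) \<in> box_algebra"
proof -
  have "disjoint (B ` I - {{}})"
    using disj unfolding disjoint_def by blast
  moreover have "(\<Union>i\<in>I. B i) = \<Union>(B ` I - {{}})" by auto
  moreover have "B ` I - {{}} \<subseteq> half_open_boxes" using assms(2) by auto
  ultimately show ?thesis using assms(1) unfolding box_algebra_def
    by (intro CollectI exI[of _ "B ` I - {{}}"]) auto
qed

text \<open>
  The part of \<open>E\<close> in the \<open>l\<close>-th diagonal block, rescaled to the unit cube without the faces through
  the origin.
\<close>

definition block_preimage :: "nat \<Rightarrow> nat \<Rightarrow> (real ^ 'n) set \<Rightarrow> (real ^ 'n) set" where
  "block_preimage m l E = {u \<in> half_open_box 0 (\<chi> k. 1). coord_map (\<lambda>t. (real l + t) / real m) u \<in> E}"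

text \<open>
  A Galois connection between \<open>ordinal_coord m l\<close> and the embedding of the unit interval as the
  \<open>l\<close>-th block. It turns preimages under the embedding into boxes with clipped vertices.
\<close>

lemma ordinal_coord_less_iff:
  assumes "m > 0" "0 < s" "s \<le> 1"
  shows "ordinal_coord m l t < s \<longleftrightarrow> t < (real l + s) / real m"
  using assms by (auto simp: ordinal_coord_def clip_def field_simps)

lemma block_preimage_box:
  fixes x y :: "real ^ 'n"
  assumes m: "m > 0"
  shows "block_preimage m l (half_open_box x y)
      = half_open_box (coord_map (ordinal_coord m l) x) (coord_map (ordinal_coord m l) y)"
    (is "?L = ?R")
proof (rule set_eqI)
  fix u :: "real ^ 'n"
  have range: "0 \<le> ordinal_coord m l t \<and> ordinal_coord m l t \<le> 1" for t
    by (auto simp: ordinal_coord_def clip_def)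
  have "0 < u $ k \<and> u $ k \<le> 1 \<and> x $ k < (real l + u $ k) / real m \<and> (real l + u $ k) / real m \<le> y $ k
      \<longleftrightarrow> ordinal_coord m l (x $ k) < u $ k \<and> u $ k \<le> ordinal_coord m l (y $ k)" for k
    using ordinal_coord_less_iff[OF m, of "u $ k" l "x $ k"] ordinal_coord_less_iff[OF m, of "u $ k" l "y $ k"]
      range[of "x $ k"] range[of "y $ k"] by (smt (verit))
  then show "u \<in> ?L \<longleftrightarrow> u \<in> ?R"
    by (simp add: block_preimage_def half_open_box_def) blast
qed

lemma block_preimage_box_algebra:
  assumes m: "m > 0" and E: "E \<in> box_algebra"
  shows "block_preimage m l E \<in> box_algebra"
proof -
  obtain P where P: "finite P" "P \<subseteq> half_open_boxes" "disjoint P" "E = \<Union>P"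
    using E by (auto simp: box_algebra_def)
  have "(\<Union>R\<in>P. block_preimage m l R) \<in> box_algebra"
  proof (rule UN_in_box_algebra[OF P(1)])
    fix R assume "R \<in> P"
    then obtain x y where "x \<in> unit_cube" "y \<in> unit_cube" "R = half_open_box x y"
      using P(2) by (auto simp: half_open_boxes_def)
    then show "block_preimage m l R \<in> half_open_boxes \<or> block_preimage m l R = {}"
      by (simp only: block_preimage_box[OF m], intro half_open_box_cases)
        (auto simp: ordinal_coord_def clip_def unit_cube_def)
  next
    fix R R' assume "R \<in> P" "R' \<in> P" "R \<noteq> R'"
    then show "block_preimage m l R \<inter> block_preimage m l R' = {}"
      using disjointD[OF P(3), of R R'] by (auto simp: block_preimage_def)
  qed
  moreover have "(\<Union>R\<in>P. block_preimage m l R) = block_preimage m l E"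
    by (auto simp: block_preimage_def P(4))
  ultimately show ?thesis by simp
qed

text \<open>
  The measure of the ordinal sum is the average of rescaled copies of the measure of \<open>A\<close>. By
  uniqueness it suffices to compare both sides on boxes. There the left-hand side is, by linearity,
  the average of the volumes of the functions \<open>A \<circ> ordinal_coord m l\<close>, which are the
  volumes of \<open>A\<close> on the clipped boxes.
\<close>

lemma induced_measure_ordinal_sum:
  fixes A :: "real ^ 'n \<Rightarrow> real"
  assumes m: "m > 0" and E: "E \<in> box_algebra"
  shows "induced_measure (coord_average m (ordinal_coord m) A) E
      = (\<Sum>l<m. induced_measure A (block_preimage m l E)) / real m"
proof -
  define \<nu> where "\<nu> = (\<lambda>E\<in>box_algebra. (\<Sum>l<m. induced_measure A (block_preimage m l E)) / real m)"
  note A = induced_measure_is[of A]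
  have "is_induced_measure (coord_average m (ordinal_coord m) A) \<nu>"
    unfolding is_induced_measure_def
  proof (intro conjI ballI impI)
    show "\<nu> \<in> extensional box_algebra" by (simp add: \<nu>_def)
    show "additive box_algebra \<nu>" unfolding additive_def
    proof (intro ballI impI)
      fix E F :: "(real ^ 'n) set"
      assume EF: "E \<in> box_algebra" "F \<in> box_algebra" "E \<inter> F = {}"
      have "induced_measure A (block_preimage m l (E \<union> F))
          = induced_measure A (block_preimage m l E) + induced_measure A (block_preimage m l F)" for l
      proof -
        have "block_preimage m l (E \<union> F) = block_preimage m l E \<union> block_preimage m l F"
          by (auto simp: block_preimage_def)
        moreover have "block_preimage m l E \<inter> block_preimage m l F = {}"
          using EF(3) by (auto simp: block_preimage_def)
        ultimately show ?thesis
          using A EF(1,2)[THEN block_preimage_box_algebra[OF m]]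
          by (auto simp: is_induced_measure_def additive_def)
      qed
      then show "\<nu> (E \<union> F) = \<nu> E + \<nu> F"
        using EF box_algebra_Un[OF EF] by (simp add: \<nu>_def sum.distrib add_divide_distrib)
    qed
    fix x y :: "real ^ 'n"
    assume x: "x \<in> unit_cube" and y: "y \<in> unit_cube" and xy: "\<forall>k. x $ k < y $ k"
    have box: "induced_measure A (block_preimage m l (half_open_box x y))
        = box_volume (\<lambda>v. A (coord_map (ordinal_coord m l) v)) x y" if l: "l < m" for l
    proof -
      let ?x = "coord_map (ordinal_coord m l) x" and ?y = "coord_map (ordinal_coord m l) y"
      have c: "?x \<in> unit_cube" "?y \<in> unit_cube"
        by (auto simp: ordinal_coord_def clip_def unit_cube_def)
      show ?thesis
      proof (cases "\<forall>k. ?x $ k < ?y $ k")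
        case True
        then have "induced_measure A (half_open_box ?x ?y) = box_volume A ?x ?y"
          using A c by (auto simp: is_induced_measure_def)
        then show ?thesis
          using box_volume_coord_map[of x y "ordinal_coord m l" A] True xy
          by (simp add: block_preimage_box[OF m])
      next
        case False
        then obtain k where "?y $ k \<le> ?x $ k" by (auto simp: not_less)
        moreover have "?x $ k \<le> ?y $ k"
          using mean_identity_ordinal_coord[OF m] l xy
          by (simp add: mean_identity_def less_imp_le monoD[of "ordinal_coord m l"])
        ultimately have k: "?x $ k = ?y $ k" by simp
        then have "half_open_box ?x ?y = {}" by (intro half_open_box_empty[of _ k]) simp
        then show ?thesis
          using box_volume_coord_map_degenerate[of x y "ordinal_coord m l" k A] k xy
          by (simp add: block_preimage_box[OF m] induced_measure_empty)
      qed
    qed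
    have vertex: "v \<in> unit_cube" if "v \<in> {v. \<forall>j. v $ j \<in> {x $ j, y $ j}}" for v
      unfolding unit_cube_def
    proof (clarify)
      fix j show "0 \<le> v $ j \<and> v $ j \<le> 1"
        using that x y by (auto simp: unit_cube_def dest: spec[of _ j])
    qed
    have "\<nu> (half_open_box x y) = (\<Sum>l<m. box_volume (\<lambda>v. A (coord_map (ordinal_coord m l) v)) x y) / real m"
      using half_open_boxes_algebra[of "half_open_box x y"] x y xy
      by (auto simp: \<nu>_def box half_open_boxes_def)
    also have "\<dots> = (\<Sum>v\<in>{v. \<forall>j. v $ j \<in> {x $ j, y $ j}}. \<Sum>l<m. box_sign x v * A (coord_map (ordinal_coord m l) v)) / real m"
      unfolding box_volume_def by (subst sum.swap) simp
    also have "\<dots> = box_volume (coord_average m (ordinal_coord m) A) x y"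
      unfolding box_volume_def sum_divide_distrib
      using vertex by (intro sum.cong refl) (simp add: coord_average_def sum_distrib_left sum_divide_distrib)
    finally show "\<nu> (half_open_box x y) = box_volume (coord_average m (ordinal_coord m) A) x y" .
  qed
  from induced_measure_eqI[OF this] show ?thesis using E by (simp add: \<nu>_def)
qed


section \<open>The transposition shuffle\<close>

text \<open>
  Pieces are counted from \<open>1\<close>: piece \<open>i\<close> of block \<open>l\<close>, both counted from \<open>0\<close>, has the index
  \<open>l m + i + 1\<close> before and \<open>i m + l + 1\<close> after the shuffle.
\<close>

definition transpose_index :: "nat \<Rightarrow> nat \<Rightarrow> nat" where
  "transpose_index m j = (if j \<in> {1..m * m} then ((j - 1) mod m) * m + (j - 1) div m + 1 else j)"

lemma index_less_square:
  assumes "l < m" "i < m" shows "l * m + i < m * (m :: nat)"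
proof -
  have "Suc l * m \<le> m * m" using assms by (intro mult_le_mono) auto
  then show ?thesis using assms by simp
qed

lemma transpose_index_eq:
  assumes "l < m" "i < m"
  shows "transpose_index m (l * m + i + 1) = i * m + l + 1"
  using assms index_less_square[OF assms] by (auto simp: transpose_index_def)

lemma index_decompose:
  assumes "j \<in> {1..m * m}"
  obtains l i where "l < m" "i < m" "j = l * m + i + (1 :: nat)"
proof
  show "(j - 1) div m < m" using assms by (intro less_mult_imp_div_less) auto
  show "(j - 1) mod m < m" using assms by (cases m) auto
  show "j = (j - 1) div m * m + (j - 1) mod m + 1" using assms by simp
qed

lemma transpose_index_permutes: "transpose_index m permutes {1..m * m}"
proof (rule bij_imp_permutes)
  have *: "transpose_index m j \<in> {1..m * m} \<and> transpose_index m (transpose_index m j) = j"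
    if j: "j \<in> {1..m * m}" for j
  proof -
    obtain l i where li: "l < m" "i < m" "j = l * m + i + 1" using index_decompose[OF j] .
    show ?thesis
      using transpose_index_eq[OF li(1,2)] transpose_index_eq[OF li(2,1)] li index_less_square[OF li(2,1)] by simp
  qed
  then show "bij_betw (transpose_index m) {1..m * m} {1..m * m}"
    by (intro bij_betw_byWitness[where f' = "transpose_index m"]) blast+
qed (auto simp: transpose_index_def)

lemma uniform_shuffle_data:
  assumes "n > 0" "p permutes {1..n}"
  shows "shuffle_data n (\<lambda>i. real i / real n) p"
  using assms by (auto simp: shuffle_data_def divide_right_mono)

text \<open>
  For pieces of equal length \<open>1 / n\<close> the piece with index \<open>j\<close> is moved by \<open>p j - j\<close> steps, because
  exactly \<open>p j - 1\<close> pieces are placed before it.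
\<close>

lemma uniform_shuffle_coord:
  assumes n: "n > 0" and p: "p permutes {1..n}" and j: "j \<in> {1..n}"
    and t: "real (j - 1) / real n < t" "t \<le> real j / real n"
  shows "shuffle_coord n (\<lambda>i. real i / real n) p t = t + (real (p j) - real j) / real n"
proof -
  have "t > 0" using t(1) by (rule order.strict_trans1[rotated]) simp
  have the: "(THE i. i \<in> {1..n} \<and> t \<in> {real (i - 1) / real n<..real i / real n}) = j"
  proof (rule the_equality)
    fix i assume i: "i \<in> {1..n} \<and> t \<in> {real (i - 1) / real n<..real i / real n}"
    have "real (i - 1) / real n < real j / real n" "real (j - 1) / real n < real i / real n"
      using i t by auto
    then have "i - 1 < j" "j - 1 < i" using n by (simp_all add: divide_simps)
    then show "i = j" using i j by auto
  qed (use j t in auto)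
  have pj: "p j \<in> {1..n}" using permutes_in_image[OF p] j by blast
  have "bij_betw p {i \<in> {1..n}. p i < p j} {1..<p j}"
  proof (rule bij_betw_imageI)
    show "inj_on p {i \<in> {1..n}. p i < p j}" using permutes_inj[OF p] by (rule inj_on_subset) auto
    show "p ` {i \<in> {1..n}. p i < p j} = {1..<p j}"
    proof (intro equalityI subsetI)
      fix q assume q: "q \<in> {1..<p j}"
      then have "q \<in> p ` {1..n}" using permutes_image[OF p] pj by auto
      then show "q \<in> p ` {i \<in> {1..n}. p i < p j}" using q by auto
    qed (use permutes_in_image[OF p] in auto)
  qed
  then have "card {i \<in> {1..n}. p i < p j} = p j - 1" by (simp add: bij_betw_same_card)
  moreover have "measure lborel {real (i - 1) / real n<..real i / real n} = 1 / real n"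
    if "i \<in> {i \<in> {1..n}. p i < p j}" for i
    using that by (simp add: divide_right_mono of_nat_diff diff_divide_distrib)
  ultimately have sum: "(\<Sum>i | i \<in> {1..n} \<and> p i < p j. measure lborel {real (i - 1) / real n<..real i / real n})
      = real (p j - 1) / real n" by simp
  have "shuffle_coord n (\<lambda>i. real i / real n) p t = t - real (j - 1) / real n + real (p j - 1) / real n"
    unfolding shuffle_coord_def Let_def the sum using \<open>t > 0\<close> by simp
  then show ?thesis using j pj by (simp add: of_nat_diff diff_divide_distrib)
qed

lemma uniform_cell_exists:
  assumes "n > 0" "0 < t" "t \<le> 1"
  obtains j where "j \<in> {1..n}" "real (j - 1) / real n < t" "t \<le> real j / real n"
proof
  let ?j = "nat \<lceil>real n * t\<rceil>"
  have c: "real n * t \<le> of_int \<lceil>real n * t\<rceil>" "of_int \<lceil>real n * t\<rceil> < real n * t + 1" "0 < real n * t"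
    using assms by (auto, linarith)
  have r: "real ?j = of_int \<lceil>real n * t\<rceil>" using c by simp
  have "\<lceil>real n * t\<rceil> \<le> int n" using assms by (simp add: ceiling_le_iff mult_left_le)
  then show j: "?j \<in> {1..n}" using c assms by (auto simp: Suc_le_eq)
  show "real (?j - 1) / real n < t" "t \<le> real ?j / real n"
    using c j r assms by (auto simp: of_nat_diff field_simps)
qed

definition transpose_coord :: "nat \<Rightarrow> real \<Rightarrow> real" where
  "transpose_coord m = shuffle_coord (m * m) (\<lambda>i. real i / real (m * m)) (transpose_index m)"

lemma transpose_coord_block:
  assumes l: "l < m" and i: "i < m" and r: "0 < r" "r \<le> 1"
  shows "transpose_coord m ((real l + (real i + r) / real m) / real m) = (real (i * m + l) + r) / real (m * m)"
proof -
  have m: "m > 0" using l by simp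
  have t: "(real l + (real i + r) / real m) / real m = (real (l * m + i) + r) / real (m * m)"
    using m by (simp add: field_simps)
  have "l * m + i + 1 \<in> {1..m * m}" using index_less_square[OF l i] by auto
  from uniform_shuffle_coord[OF _ transpose_index_permutes this, of "(real (l * m + i) + r) / real (m * m)"]
  show ?thesis using m r unfolding t transpose_coord_def transpose_index_eq[OF l i]
    by (simp add: divide_strict_right_mono divide_right_mono flip: add_divide_distrib)
qed

text \<open>
  A second Galois connection: restricted to one block, the transposition is increasing, and
  \<open>interleaved_coord m l\<close> is its upper adjoint. The moved pieces of one block begin at distances of
  \<open>m\<close> units of length \<open>1 / m\<^sup>2\<close>, and each is one unit long. Hence if \<open>x\<close> lies within the moved
  piece \<open>i\<close>, then all earlier pieces are completely to the left of \<open>x\<close> and all later ones to the right.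
\<close>

lemma transpose_coord_block_le_iff:
  assumes l: "l < m" and u: "0 < u" "u \<le> 1"
  shows "0 < transpose_coord m ((real l + u) / real m)"
    and "transpose_coord m ((real l + u) / real m) \<le> x \<longleftrightarrow> u \<le> interleaved_coord m l x"
proof -
  have m: "m > 0" using l by simp
  obtain j where j: "j \<in> {1..m}" "real (j - 1) / real m < u" "u \<le> real j / real m"
    using uniform_cell_exists[OF m u] .
  define i where "i = j - 1"
  define r where "r = real m * u - real i"
  have i: "i < m" using j by (auto simp: i_def)
  have r: "0 < r" "r \<le> 1" using j m by (auto simp: r_def i_def field_simps of_nat_diff)
  have ui: "u = (real i + r) / real m" using m by (simp add: r_def)
  have val: "transpose_coord m ((real l + u) / real m) = (real (i * m + l) + r) / real (m * m)"
    unfolding ui by (rule transpose_coord_block[OF l i r])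
  show "0 < transpose_coord m ((real l + u) / real m)" unfolding val using r m
    by (intro divide_pos_pos add_nonneg_pos) auto
  define y where "y = (\<lambda>i. real (m * m) * x - real (i * m + l))"
  have L: "transpose_coord m ((real l + u) / real m) \<le> x \<longleftrightarrow> r \<le> y i"
    unfolding val y_def using m by (simp add: divide_le_eq) (auto simp: algebra_simps)
  have R: "u \<le> interleaved_coord m l x \<longleftrightarrow> real i + r \<le> (\<Sum>i<m. clip (y i))"
    unfolding ui interleaved_coord_def y_def using m by (simp add: divide_le_cancel)
  have split: "(\<Sum>i<m. clip (y i)) = (\<Sum>i'<i. clip (y i')) + clip (y i) + (\<Sum>i'\<in>{i<..<m}. clip (y i'))"
  proof -
    have set: "{..<m} = {..<i} \<union> insert i {i<..<m}" using i by auto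
    show ?thesis unfolding set by (subst sum.union_disjoint) auto
  qed
  have step: "y i' \<ge> y i'' + real m" if "i' < i''" for i' i''
  proof -
    have "Suc i' * m \<le> i'' * m" using that by (intro mult_le_mono) auto
    then have "real (i' * m + m) \<le> real (i'' * m)" by (simp only: of_nat_le_iff) simp
    then show ?thesis by (simp add: y_def)
  qed
  show "transpose_coord m ((real l + u) / real m) \<le> x \<longleftrightarrow> u \<le> interleaved_coord m l x"
    unfolding L R
  proof
    assume ry: "r \<le> y i"
    have "clip (y i') = 1" if "i' < i" for i'
      using step[OF that] ry r m by (simp add: clip_def)
    then have "(\<Sum>i'<i. clip (y i')) = real i" by simp
    moreover have "0 \<le> (\<Sum>i'\<in>{i<..<m}. clip (y i'))" by (intro sum_nonneg) (simp add: clip_def)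
    moreover have "r \<le> clip (y i)" using ry r by (simp add: clip_def)
    ultimately show "real i + r \<le> (\<Sum>i<m. clip (y i))" unfolding split by linarith
  next
    assume le: "real i + r \<le> (\<Sum>i<m. clip (y i))"
    show "r \<le> y i"
    proof (rule ccontr)
      assume n: "\<not> r \<le> y i"
      have "clip (y i') = 0" if "i' \<in> {i<..<m}" for i'
        using step[of i i'] that n r m by (simp add: clip_def)
      then have "(\<Sum>i'\<in>{i<..<m}. clip (y i')) = 0" by simp
      moreover have "(\<Sum>i'<i. clip (y i')) \<le> (\<Sum>i'<i. 1)" by (intro sum_mono) (simp add: clip_def)
      moreover have "clip (y i) < r" using n r by (auto simp: clip_def)
      ultimately show False using le unfolding split by simp
    qed
  qed
qed

text \<open>
  The induced measure is only meaningful on finite unions of boxes. The shuffle is a translation on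
  each cell of the grid of width \<open>1 / n\<close>, so the preimage meets each cell in a box or not at all.
\<close>

lemma uniform_shuffle_preimage_box_algebra:
  fixes x :: "real ^ 'n"
  assumes n: "n > 0" and p: "p permutes {1..n}"
  defines "\<phi> \<equiv> shuffle_coord n (\<lambda>i. real i / real n) p"
  shows "{t \<in> unit_cube. coord_map \<phi> t \<in> half_open_box 0 x} \<in> box_algebra"
proof -
  define lo where "lo = (\<lambda>c. \<chi> k::'n. real (c k - 1) / real n)"
  define hi where "hi = (\<lambda>c. \<chi> k::'n. min (real (c k) / real n) (x $ k - (real (p (c k)) - real (c k)) / real n))"
  \<comment> \<open>A cell is given by its index \<open>c k\<close> in each coordinate; \<open>lo c\<close> and \<open>hi c\<close> are the opposite
    vertices of its part in the preimage. For some cells \<open>hi c\<close> is not above \<open>lo c\<close>, and the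
    part is empty.\<close>
  let ?I = "{c. \<forall>k::'n. c k \<in> {1..n}}"
  let ?E = "{t \<in> unit_cube. coord_map \<phi> t \<in> half_open_box 0 x}"
  have finI: "finite ?I" using finite_PiE[of UNIV "\<lambda>_::'n. {1..n}"] by (simp add: PiE_UNIV_domain Pi_def)
  have pos: "0 < \<phi> t" if t: "0 < t" "t \<le> 1" for t
  proof -
    obtain j where j: "j \<in> {1..n}" "real (j - 1) / real n < t" "t \<le> real j / real n"
      using uniform_cell_exists[OF n t] .
    have "p j \<in> {1..n}" using permutes_in_image[OF p] j by blast
    then show ?thesis unfolding \<phi>_def uniform_shuffle_coord[OF n p j]
      using j n by (auto simp: field_simps of_nat_diff)
  qed
  have coord: "0 < t \<and> t \<le> 1 \<and> \<phi> t \<le> X" 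
    if j: "j \<in> {1..n}" and t: "real (j - 1) / real n < t" "t \<le> min (real j / real n) (X - (real (p j) - real j) / real n)" for j t X
  proof -
    have t': "t \<le> real j / real n" using t by simp
    have "0 \<le> real (j - 1) / real n" by simp
    then have "0 < t" using t by linarith
    moreover have "real j / real n \<le> 1" using j n by simp
    ultimately show ?thesis using uniform_shuffle_coord[OF n p j t(1) t'] t by (auto simp: \<phi>_def)
  qed
  have "(\<Union>c\<in>?I. half_open_box (lo c) (hi c)) \<in> box_algebra"
  proof (rule UN_in_box_algebra[OF finI])
    fix c assume c: "c \<in> ?I"
    have le: "c k \<le> n" for k using c by auto
    then have "real (c k - 1) \<le> real n" for k by (intro of_nat_mono order_trans[OF diff_le_self])
    with le show "half_open_box (lo c) (hi c) \<in> half_open_boxes \<or> half_open_box (lo c) (hi c) = {}"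
      using n by (intro half_open_box_cases) (auto simp: lo_def hi_def unit_cube_def min_le_iff_disj)
  next
    fix c c' assume c: "c \<in> ?I" "c' \<in> ?I" "c \<noteq> c'"
    then obtain k where k: "c k \<noteq> c' k" by (auto simp: fun_eq_iff)
    show "half_open_box (lo c) (hi c) \<inter> half_open_box (lo c') (hi c') = {}"
    proof (rule ccontr)
      assume "half_open_box (lo c) (hi c) \<inter> half_open_box (lo c') (hi c') \<noteq> {}"
      then obtain u where u: "u \<in> half_open_box (lo c) (hi c)" "u \<in> half_open_box (lo c') (hi c')" by blast
      have "real (c k - 1) / real n < real (c' k) / real n" "real (c' k - 1) / real n < real (c k) / real n"
        using u[unfolded half_open_box_def mem_Collect_eq, THEN spec[of _ k]] by (auto simp: lo_def hi_def)
      then have "c k - 1 < c' k" "c' k - 1 < c k" using n by (simp_all add: divide_simps)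
      then show False using k c by (auto simp: not_less_eq dest!: spec[of _ k])
    qed
  qed
  moreover have "(\<Union>c\<in>?I. half_open_box (lo c) (hi c)) = ?E"
  proof (intro equalityI subsetI)
    fix t assume "t \<in> (\<Union>c\<in>?I. half_open_box (lo c) (hi c))"
    then obtain c where c: "\<And>k. c k \<in> {1..n}" and t: "t \<in> half_open_box (lo c) (hi c)" by auto
    have "0 < t $ k \<and> t $ k \<le> 1 \<and> \<phi> (t $ k) \<le> x $ k" for k
      using t coord[OF c[of k], of "t $ k" "x $ k"] by (auto simp: half_open_box_def lo_def hi_def)
    then show "t \<in> ?E" using pos by (auto simp: unit_cube_def half_open_box_def less_imp_le)
  next
    fix t assume t: "t \<in> ?E"
    have "\<phi> 0 = 0" by (simp add: \<phi>_def shuffle_coord_def)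
    have t': "0 < t $ k" "t $ k \<le> 1" "\<phi> (t $ k) \<le> x $ k" for k
    proof -
      have *: "0 < \<phi> (t $ k)" "\<phi> (t $ k) \<le> x $ k" "0 \<le> t $ k" "t $ k \<le> 1"
        using t by (auto simp: half_open_box_def unit_cube_def)
      then have "t $ k \<noteq> 0" using \<open>\<phi> 0 = 0\<close> by auto
      then show "0 < t $ k" "t $ k \<le> 1" "\<phi> (t $ k) \<le> x $ k" using * by auto
    qed
    have "\<exists>j. j \<in> {1..n} \<and> real (j - 1) / real n < t $ k \<and> t $ k \<le> real j / real n" for k
      using uniform_cell_exists[OF n t'(1,2)] by metis
    then obtain c where c: "\<And>k. c k \<in> {1..n}" "\<And>k. real (c k - 1) / real n < t $ k" "\<And>k. t $ k \<le> real (c k) / real n"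
      by metis
    have "t \<in> half_open_box (lo c) (hi c)"
      using c t'(3) uniform_shuffle_coord[OF n p c] by (auto simp: half_open_box_def lo_def hi_def \<phi>_def algebra_simps)
    then show "t \<in> (\<Union>c\<in>?I. half_open_box (lo c) (hi c))" using c(1) by blast
  qed
  ultimately show ?thesis by simp
qed

text \<open>
  The measure of the preimage is an average over the blocks by \<open>induced_measure_ordinal_sum\<close>, and by the
  second Galois connection its part in the \<open>l\<close>-th block is the box from the origin to
  \<open>coord_map (interleaved_coord m l) x\<close>, on which the measure induced by \<open>A\<close> is the value of \<open>A\<close>.
\<close>

lemma interleaving_is_shuffle:
  fixes A :: "real ^ 'n \<Rightarrow> real"
  assumes A: "A \<in> quasi_copulas" and m: "m > 0"
  shows "coord_average m (interleaved_coord m) A \<in> shuffles_of (coord_average m (ordinal_coord m) A)"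
proof -
  let ?Q = "coord_average m (ordinal_coord m) A"
  let ?\<phi> = "shuffle_map (\<lambda>_::'n. m * m) (\<lambda>_ i. real i / real (m * m)) (\<lambda>_. transpose_index m)"
  have mm: "m * m > 0" using m by simp
  have map: "?\<phi> t = coord_map (transpose_coord m) t" for t
    by (simp add: shuffle_map_def transpose_coord_def coord_map_def)
  have "coord_average m (interleaved_coord m) A
      = (\<lambda>x\<in>unit_cube. induced_measure ?Q {t \<in> unit_cube. ?\<phi> t \<in> half_open_box 0 x})"
  proof (rule extensionalityI[of _ unit_cube])
    fix x :: "real ^ 'n" assume x: "x \<in> unit_cube"
    let ?E = "{t \<in> unit_cube. coord_map (transpose_coord m) t \<in> half_open_box 0 x}"
    have E: "?E \<in> box_algebra"
      unfolding transpose_coord_def by (rule uniform_shuffle_preimage_box_algebra[OF mm transpose_index_permutes])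
    have "induced_measure A (block_preimage m l ?E) = A (coord_map (interleaved_coord m l) x)" if l: "l < m" for l
    proof -
      have c: "coord_map (interleaved_coord m l) x \<in> unit_cube"
        using x mean_identity_interleaved_coord[OF m] l by (intro coord_map_unit_cube) (auto simp: mean_identity_def)
      have "block_preimage m l ?E = half_open_box 0 (coord_map (interleaved_coord m l) x)"
      proof (rule set_eqI)
        fix u :: "real ^ 'n"
        have range: "interleaved_coord m l (x $ k) \<le> 1" for k
          using c by (auto simp: unit_cube_def)
        have in01: "0 \<le> (real l + s) / real m \<and> (real l + s) / real m \<le> 1" if "0 < s" "s \<le> 1" for s
          using that l by (auto simp: field_simps)
        have "0 < u $ k \<and> u $ k \<le> 1 \<and> 0 \<le> (real l + u $ k) / real m \<and> (real l + u $ k) / real m \<le> 1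
            \<and> 0 < transpose_coord m ((real l + u $ k) / real m)
            \<and> transpose_coord m ((real l + u $ k) / real m) \<le> x $ k
          \<longleftrightarrow> 0 < u $ k \<and> u $ k \<le> interleaved_coord m l (x $ k)" for k
          using transpose_coord_block_le_iff(1)[OF l, of "u $ k"]
            transpose_coord_block_le_iff(2)[OF l, of "u $ k" "x $ k"] in01[of "u $ k"] range[of k] by (smt (verit))
        then show "u \<in> block_preimage m l ?E \<longleftrightarrow> u \<in> half_open_box 0 (coord_map (interleaved_coord m l) x)"
          by (simp add: block_preimage_def half_open_box_def unit_cube_def) blast
      qed
      then show ?thesis using induced_measure_from_zero[OF A c] by simp
    qed
    then show "coord_average m (interleaved_coord m) A x
        = (\<lambda>x\<in>unit_cube. induced_measure ?Q {t \<in> unit_cube. ?\<phi> t \<in> half_open_box 0 x}) x"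
      using induced_measure_ordinal_sum[OF m E, of A] x unfolding map by (simp add: coord_average_def)
  qed (simp_all add: coord_average_def)
  then show ?thesis
    unfolding shuffles_of_def
    using uniform_shuffle_data[OF mm transpose_index_permutes] by blast
qed


section \<open>Density\<close>

theorem theorem14:
  fixes \<U> :: "(real ^ 'n \<Rightarrow> real) set"
  assumes "CARD('n) \<ge> 2"
    and "\<U> \<subseteq> quasi_copulas"
    and "\<exists>T. openin quasi_copula_topology T \<and> min_copula \<in> T \<and> T \<subseteq> \<U>"
  shows "quasi_copula_topology closure_of ((\<Union>Q\<in>\<U>. shuffles_of Q) \<inter> quasi_copulas) = quasi_copulas"
proof -
  interpret Metric_space "quasi_copulas :: (real ^ 'n \<Rightarrow> real) set" uniform_dist
    by (rule Metric_space_quasi_copulas)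
  obtain T where T: "openin mtopology T" "min_copula \<in> T" "T \<subseteq> \<U>"
    using assms(3) unfolding quasi_copula_topology_def by auto
  then obtain \<delta> where \<delta>: "\<delta> > 0" "mball min_copula \<delta> \<subseteq> \<U>"
    unfolding openin_mtopology by (meson order_trans)
  have "\<exists>B\<in>(\<Union>Q\<in>\<U>. shuffles_of Q) \<inter> quasi_copulas. B \<in> mball A \<epsilon>"
    if A: "A \<in> quasi_copulas" and \<epsilon>: "\<epsilon> > 0" for A and \<epsilon> :: real
  proof -
    obtain m :: nat where m: "real m > max (1 / \<delta>) (real CARD('n) / \<epsilon>)"
      using reals_Archimedean2 by blast
    have "m > 0"
    proof (rule ccontr)
      assume "\<not> m > 0"
      then show False using m \<delta>(1) by (simp add: not_less)
    qed
    let ?Q = "coord_average m (ordinal_coord m) A" and ?S = "coord_average m (interleaved_coord m) A"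
    have Q: "?Q \<in> quasi_copulas" and S: "?S \<in> quasi_copulas"
      using coord_average_quasi_copula[OF A] mean_identity_ordinal_coord[OF \<open>m > 0\<close>]
        mean_identity_interleaved_coord[OF \<open>m > 0\<close>] by blast+
    have "1 / real m < \<delta>" "real CARD('n) / real m < \<epsilon>"
      using m \<open>m > 0\<close> \<delta>(1) \<epsilon> by (simp_all add: field_simps)
    then have "uniform_dist min_copula ?Q < \<delta>" "uniform_dist A ?S < \<epsilon>"
      using coord_average_close_to_min[OF A \<open>m > 0\<close>] coord_average_close_to_self[OF A \<open>m > 0\<close>] by linarith+
    then have "?Q \<in> \<U>" "?S \<in> mball A \<epsilon>"
      using \<delta>(2) Q S A min_copula_quasi_copula by (auto simp: in_mball)
    then show ?thesis using interleaving_is_shuffle[OF A \<open>m > 0\<close>] S by blast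
  qed
  then show ?thesis unfolding quasi_copula_topology_def metric_closure_of by blast
qed

end
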